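(* Let $\sigma_1,\sigma_2$ be two non-empty normal swords. Then the identity $\sigma_1\approx\sigma_2$ holds in the class $\mathfrak{E}$ of all epigroups if and only if $\sigma_1=\sigma_2$ (as swords). Likewise, the identity $\sigma_1\approx\sigma_2$ holds in the class $\mathfrak{E}_{fin}$ of all finite epigroups if and only if $\sigma_1=\sigma_2$.
   Context: Fix a non-empty alphabet $A$ and a symbol $\omega$. $\mathbb{Z}$-unary words over $A$ are defined inductively: the empty word is a $\mathbb{Z}$-unary word; each letter of $A$ is one; if $\sigma$ is a non-empty $\mathbb{Z}$-unary word and $q\in\mathbb{Z}$, the formal expression $(\sigma)^{\omega+q}$ is one; the concatenation of two $\mathbb{Z}$-unary words is one. Let $Z(A)$ be the set of all $\mathbb{Z}$-unary words; under concatenation it is the free monoid on $A$ together with all formal expressions $(\sigma)^{\omega+q}$. Let $\mathcal{S}$ be the smallest equivalence relation on $Z(A)$ that is compatible with concatenation and with all unary operations $\sigma\mapsto\sigma^{\omega+q}$ and contains all pairs $(x^{\omega+q},xx^{\omega+q-1})$, $(x^{\omega+q},x^{\omega+q-1}x)$, $(x(yx)^{\omega+q},(xy)^{\omega+q}x)$ with $x,y$ non-empty $\mathbb{Z}$-unary words and $q\in\mathbb{Z}$. An $\mathcal{S}$-class is called a sword. Let $\mathcal{R}$ be the rewriting system on $Z(A)$ with the rules $x^{\omega+q}x^{\omega+r}\to x^{\omega+q+r}$, $(x^n)^{\omega+q}\to x^{\omega+nq}$, $(x^{\omega+r})^{\omega+q}\to x^{\omega+rq}$ for all non-empty $x\in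 Z(A)$, all $q,r\in\mathbb{Z}$ and all integers $n\ge2$; $\sigma\to\tau$ means that $\tau$ arises from $\sigma$ by one application of a rule to a subexpression (possibly inside $\omega$-powers). For swords $\alpha,\beta$ write $\alpha\to_{\mathcal{R}/\mathcal{S}}\beta$ if $\sigma\to\tau$ for some $\mathbb{Z}$-unary words $\sigma$ representing $\alpha$ and $\tau$ representing $\beta$. A sword $\alpha$ is normal if there is no sword $\beta$ with $\alpha\to_{\mathcal{R}/\mathcal{S}}\beta$. A semigroup $S$ is an epigroup if for every $x\in S$ some power of $x$ belongs to a subgroup of $S$. For every element $x$ of an epigroup there is a unique maximal subgroup $G_x$ containing all but finitely many powers of $x$; if $e_x$ is the identity of $G_x$, then $xe_x=e_xx\in G_x$, and $\overline{x}$ denotes the inverse of $xe_x$ in $G_x$. Every finite semigroup is an epigroup. Non-empty $\mathbb{Z}$-unary words are treated as epigroup terms in the variables $A$, with $x^{\omega+q}$ interpreted as $\overline{x}x^{q+1}$ if $q\ge0$ and as $\overline{x}^{\,-q}$ (the $(-q)$-th power of $\overline{x}$) if $q<0$. $\mathcal{S}$-related $\mathbb{Z}$-unary words give terms that are equal under every evaluation in every epigroup, so for swords $\sigma,\sigma'$ the identity $\sigma\approx\sigma'$ (meaning $\alpha\approx\alpha'$ for any representing $\mathbb{Z}$-unary words $\alpha,\alpha'$) is well defined. *)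

theory Defs
  imports "HOL-Algebra.Group"
begin

(* The alphabet A is the type 'a. A word is the list of its factors in the free monoid on the
   letters and the formal powers; OmegaPow w q stands for (w)^(omega+q). The type also contains
   powers of the empty word; they are excluded by the set ZWords. *)
datatype 'a zfactor = Letter 'a | OmegaPow "'a zfactor list" int

type_synonym 'a zword = "'a zfactor list"

inductive_set ZWords :: "'a zword set" where
  empty: "[] \<in> ZWords"
| letter: "[Letter a] \<in> ZWords"
| power: "\<sigma> \<in> ZWords \<Longrightarrow> \<sigma> \<noteq> [] \<Longrightarrow> [OmegaPow \<sigma> q] \<in> ZWords"
| concat: "\<sigma> \<in> ZWords \<Longrightarrow> \<tau> \<in> ZWords \<Longrightarrow> \<sigma> @ \<tau> \<in> ZWords"

definition ne_ZWords :: "'a zword set" where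
  "ne_ZWords = ZWords - {[]}"

inductive_set sword_rel :: "('a zword \<times> 'a zword) set" where
  refl: "\<sigma> \<in> ZWords \<Longrightarrow> (\<sigma>, \<sigma>) \<in> sword_rel"
| sym: "(\<sigma>, \<tau>) \<in> sword_rel \<Longrightarrow> (\<tau>, \<sigma>) \<in> sword_rel"
| trans: "(\<sigma>, \<tau>) \<in> sword_rel \<Longrightarrow> (\<tau>, \<rho>) \<in> sword_rel \<Longrightarrow> (\<sigma>, \<rho>) \<in> sword_rel"
| concat: "(\<sigma>, \<sigma>') \<in> sword_rel \<Longrightarrow> (\<tau>, \<tau>') \<in> sword_rel \<Longrightarrow> (\<sigma> @ \<tau>, \<sigma>' @ \<tau>') \<in> sword_rel"
| power: "(\<sigma>, \<tau>) \<in> sword_rel \<Longrightarrow> \<sigma> \<noteq> [] \<Longrightarrow> \<tau> \<noteq> [] \<Longrightarrow>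
    ([OmegaPow \<sigma> q], [OmegaPow \<tau> q]) \<in> sword_rel"
| unfold_left: "x \<in> ne_ZWords \<Longrightarrow> ([OmegaPow x q], x @ [OmegaPow x (q - 1)]) \<in> sword_rel"
| unfold_right: "x \<in> ne_ZWords \<Longrightarrow> ([OmegaPow x q], [OmegaPow x (q - 1)] @ x) \<in> sword_rel"
| shift: "x \<in> ne_ZWords \<Longrightarrow> y \<in> ne_ZWords \<Longrightarrow>
    (x @ [OmegaPow (y @ x) q], [OmegaPow (x @ y) q] @ x) \<in> sword_rel"

definition swords :: "'a zword set set" where
  "swords = ZWords // sword_rel"

definition empty_sword :: "'a zword set" where
  "empty_sword = sword_rel `` {[]}"

inductive zrule :: "'a zword \<Rightarrow> 'a zword \<Rightarrow> bool" where
  add: "x \<in> ne_ZWords \<Longrightarrow> zrule [OmegaPow x q, OmegaPow x r] [OmegaPow x (q + r)]"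
| root: "x \<in> ne_ZWords \<Longrightarrow> n \<ge> 2 \<Longrightarrow>
    zrule [OmegaPow (concat (replicate n x)) q] [OmegaPow x (int n * q)]"
| nest: "x \<in> ne_ZWords \<Longrightarrow> zrule [OmegaPow [OmegaPow x r] q] [OmegaPow x (r * q)]"

inductive zstep :: "'a zword \<Rightarrow> 'a zword \<Rightarrow> bool" where
  rule: "zrule \<sigma> \<tau> \<Longrightarrow> zstep \<sigma> \<tau>"
| subword: "zstep \<sigma> \<tau> \<Longrightarrow> \<pi> \<in> ZWords \<Longrightarrow> \<rho> \<in> ZWords \<Longrightarrow> zstep (\<pi> @ \<sigma> @ \<rho>) (\<pi> @ \<tau> @ \<rho>)"
| power: "zstep \<sigma> \<tau> \<Longrightarrow> zstep [OmegaPow \<sigma> q] [OmegaPow \<tau> q]"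

definition sword_step :: "'a zword set \<Rightarrow> 'a zword set \<Rightarrow> bool" where
  "sword_step \<alpha> \<beta> \<longleftrightarrow> \<alpha> \<in> swords \<and> \<beta> \<in> swords \<and> (\<exists>\<sigma>\<in>\<alpha>. \<exists>\<tau>\<in>\<beta>. zstep \<sigma> \<tau>)"

definition normal_sword :: "'a zword set \<Rightarrow> bool" where
  "normal_sword \<alpha> \<longleftrightarrow> \<alpha> \<in> swords \<and> (\<nexists>\<beta>. sword_step \<alpha> \<beta>)"

(* A semigroup is given by its carrier S and its multiplication m, so that one can quantify over
   all semigroups carried by subsets of a type. *)
definition semigroup_on :: "'s set \<Rightarrow> ('s \<Rightarrow> 's \<Rightarrow> 's) \<Rightarrow> bool" where
  "semigroup_on S m \<longleftrightarrow>
    (\<forall>x\<in>S. \<forall>y\<in>S. m x y \<in> S) \<and>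
    (\<forall>x\<in>S. \<forall>y\<in>S. \<forall>z\<in>S. m (m x y) z = m x (m y z))"

(* Meaningful for exponents n >= 1 only; likewise sg_prod below only for non-empty lists. *)
definition sg_pow :: "('s \<Rightarrow> 's \<Rightarrow> 's) \<Rightarrow> 's \<Rightarrow> nat \<Rightarrow> 's" where
  "sg_pow m x n = (m x ^^ (n - 1)) x"

definition sg_prod :: "('s \<Rightarrow> 's \<Rightarrow> 's) \<Rightarrow> 's list \<Rightarrow> 's" where
  "sg_prod m xs = foldl m (hd xs) (tl xs)"

abbreviation mk_group :: "'s set \<Rightarrow> ('s \<Rightarrow> 's \<Rightarrow> 's) \<Rightarrow> 's \<Rightarrow> 's monoid" where
  "mk_group G m e \<equiv> \<lparr>carrier = G, mult = m, one = e\<rparr>"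

definition sg_subgroup :: "'s set \<Rightarrow> ('s \<Rightarrow> 's \<Rightarrow> 's) \<Rightarrow> 's set \<Rightarrow> bool" where
  "sg_subgroup S m G \<longleftrightarrow> G \<subseteq> S \<and> (\<exists>e. group (mk_group G m e))"

definition sg_max_subgroup :: "'s set \<Rightarrow> ('s \<Rightarrow> 's \<Rightarrow> 's) \<Rightarrow> 's set \<Rightarrow> bool" where
  "sg_max_subgroup S m G \<longleftrightarrow>
    sg_subgroup S m G \<and> (\<forall>H. sg_subgroup S m H \<longrightarrow> G \<subseteq> H \<longrightarrow> H = G)"

definition epigroup :: "'s set \<Rightarrow> ('s \<Rightarrow> 's \<Rightarrow> 's) \<Rightarrow> bool" where
  "epigroup S m \<longleftrightarrow> semigroup_on S m \<and>
    (\<forall>x\<in>S. \<exists>n\<ge>1. \<exists>G. sg_subgroup S m G \<and> sg_pow m x n \<in> G)"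

(* "All but finitely many powers" refers to exponents: if the set of powers of x is finite, counting
   powers as elements would impose no condition. *)
definition epi_group :: "'s set \<Rightarrow> ('s \<Rightarrow> 's \<Rightarrow> 's) \<Rightarrow> 's \<Rightarrow> 's set" where
  "epi_group S m x = (THE G. sg_max_subgroup S m G \<and> finite {n. n \<ge> 1 \<and> sg_pow m x n \<notin> G})"

definition epi_idem :: "'s set \<Rightarrow> ('s \<Rightarrow> 's \<Rightarrow> 's) \<Rightarrow> 's \<Rightarrow> 's" where
  "epi_idem S m x = (THE e. group (mk_group (epi_group S m x) m e))"

definition pseudo_inv :: "'s set \<Rightarrow> ('s \<Rightarrow> 's \<Rightarrow> 's) \<Rightarrow> 's \<Rightarrow> 's" where
  "pseudo_inv S m x =
    (let e = epi_idem S m x in inv\<^bsub>mk_group (epi_group S m x) m e\<^esub> (m x e))"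

definition omega_pow :: "'s set \<Rightarrow> ('s \<Rightarrow> 's \<Rightarrow> 's) \<Rightarrow> 's \<Rightarrow> int \<Rightarrow> 's" where
  "omega_pow S m x q =
    (if q \<ge> 0 then m (pseudo_inv S m x) (sg_pow m x (nat (q + 1)))
     else sg_pow m (pseudo_inv S m x) (nat (- q)))"

primrec eval_zfactor :: "'s set \<Rightarrow> ('s \<Rightarrow> 's \<Rightarrow> 's) \<Rightarrow> ('a \<Rightarrow> 's) \<Rightarrow> 'a zfactor \<Rightarrow> 's" where
  "eval_zfactor S m \<phi> (Letter a) = \<phi> a"
| "eval_zfactor S m \<phi> (OmegaPow w q) = omega_pow S m (sg_prod m (map (eval_zfactor S m \<phi>) w)) q"

definition eval_zword :: "'s set \<Rightarrow> ('s \<Rightarrow> 's \<Rightarrow> 's) \<Rightarrow> ('a \<Rightarrow> 's) \<Rightarrow> 'a zword \<Rightarrow> 's" where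
  "eval_zword S m \<phi> w = sg_prod m (map (eval_zfactor S m \<phi>) w)"

definition word_identity :: "'s set \<Rightarrow> ('s \<Rightarrow> 's \<Rightarrow> 's) \<Rightarrow> 'a zword \<Rightarrow> 'a zword \<Rightarrow> bool" where
  "word_identity S m \<alpha> \<alpha>' \<longleftrightarrow>
    (\<forall>\<phi>. range \<phi> \<subseteq> S \<longrightarrow> eval_zword S m \<phi> \<alpha> = eval_zword S m \<phi> \<alpha>')"

definition sword_identity ::
  "'s set \<Rightarrow> ('s \<Rightarrow> 's \<Rightarrow> 's) \<Rightarrow> 'a zword set \<Rightarrow> 'a zword set \<Rightarrow> bool" where
  "sword_identity S m \<sigma> \<sigma>' \<longleftrightarrow> (\<forall>\<alpha>\<in>\<sigma>. \<forall>\<alpha>'\<in>\<sigma>'. word_identity S m \<alpha> \<alpha>')"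

(* HOL cannot quantify over types inside a formula: the class of all (finite) epigroups is rendered
   as all (finite) epigroups carried by subsets of 's. For infinite 's this satisfies the same
   identities as the whole class, since a term has finitely many variables and hence an identity
   is tested in countable subepigroups. *)
definition holds_in_epigroups :: "'s itself \<Rightarrow> 'a zword set \<Rightarrow> 'a zword set \<Rightarrow> bool" where
  "holds_in_epigroups (_ :: 's itself) \<sigma> \<sigma>' \<longleftrightarrow>
    (\<forall>(S :: 's set) m. epigroup S m \<longrightarrow> sword_identity S m \<sigma> \<sigma>')"

definition holds_in_finite_epigroups :: "'s itself \<Rightarrow> 'a zword set \<Rightarrow> 'a zword set \<Rightarrow> bool" where
  "holds_in_finite_epigroups (_ :: 's itself) \<sigma> \<sigma>' \<longleftrightarrow>
    (\<forall>(S :: 's set) m. epigroup S m \<and> finite S \<longrightarrow> sword_identity S m \<sigma> \<sigma>')"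

end

theory Submission
  imports Defs "HOL-Library.Countable" "HOL-Library.FuncSet"
begin

text \<open>A letter \<open>a\<close> is eliminated from an irreducible word as follows. Up to the sword relation, every
  such word is a product of factors \<open>M d\<close>, where \<open>d \<noteq> a\<close> is a letter and the block \<open>M\<close> is \<open>a\<^sup>k\<close> or
  \<open>a\<^sup>\<omega>\<^sup>+\<^sup>q\<close>, followed by one further block; adjacent blocks merge because two \<open>\<omega>\<close>-powers of \<open>a\<close>, or an
  \<open>\<omega>\<close>-power of a power of \<open>a\<close>, would be reducible. Each \<open>M d\<close> becomes a new letter, and the resulting
  word is again irreducible. Plain bases containing \<open>a\<close> become shorter, so repeated elimination leads
  to words without \<open>\<omega>\<close>-powers, and two different such words are separated by a finite automaton.
  An automaton for the new words yields one for the old words by counting the length of blocks of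
  \<open>a\<close> up to a threshold and beyond it modulo a period. Its transition semigroup is a finite epigroup in
  which the two terms differ. Conversely, the sword relation is sound for all epigroups since
  \<open>x\<close> has a unique Drazin inverse, and that of \<open>xy\<close> is obtained from that of \<open>yx\<close> by Cline's formula.\<close>

section \<open>Words and the sword relation\<close>

text \<open>Irreducibility of the new words needs no check rule by rule. New letters expand to
  non-empty words, and such substitutions preserve sword relations and rewriting steps, so a
  reduction of the new word would reduce the old one. The rules are therefore applied by hand only
  to powers of the single letter \<open>a\<close>. The obstacle is a power whose base begins and
  ends with blocks of \<open>a\<close>: they become neighbours when the base is repeated, although
  they are far apart in the base. Rotating the base brings them together, at the price of one
  unrolled copy of the base around the power. Hence word length is no measure for termination. Only
  plain bases are measured: one without \<open>a\<close> keeps its length and its letters, since a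
  letter with an empty block keeps its name, and one containing \<open>a\<close> gets shorter. Once
  no plain base is left to shorten, the bound on the nesting depth drops by one and the innermost
  bases are measured anew.\<close>

abbreviation sword_eq :: "'a zword \<Rightarrow> 'a zword \<Rightarrow> bool" (infix "\<approx>" 50) where
  "x \<approx> y \<equiv> (x, y) \<in> sword_rel"

lemmas sword_eq_trans [trans] = sword_rel.trans

lemma ZWords_iff: "w \<in> ZWords \<longleftrightarrow> (\<forall>x q. OmegaPow x q \<in> set w \<longrightarrow> x \<in> ZWords \<and> x \<noteq> [])"
proof
  show "w \<in> ZWords \<Longrightarrow> \<forall>x q. OmegaPow x q \<in> set w \<longrightarrow> x \<in> ZWords \<and> x \<noteq> []"
    by (induction rule: ZWords.induct) auto
next
  show "\<forall>x q. OmegaPow x q \<in> set w \<longrightarrow> x \<in> ZWords \<and> x \<noteq> [] \<Longrightarrow> w \<in> ZWords"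
  proof (induction w)
    case Nil
    show ?case by (rule ZWords.empty)
  next
    case (Cons f w)
    have "[f] \<in> ZWords"
      using Cons.prems by (cases f) (auto intro: ZWords.letter ZWords.power)
    moreover have "w \<in> ZWords" using Cons by auto
    ultimately show ?case using ZWords.concat[of "[f]" w] by simp
  qed
qed

lemma append_ZWords [simp]: "u @ v \<in> ZWords \<longleftrightarrow> u \<in> ZWords \<and> v \<in> ZWords"
  by (subst (1 2 3) ZWords_iff) auto

lemma ZWords_simps [simp]:
  shows Nil_ZWords: "[] \<in> ZWords"
    and Letter_ZWords: "Letter a # w \<in> ZWords \<longleftrightarrow> w \<in> ZWords"
    and OmegaPow_ZWords: "OmegaPow x q # w \<in> ZWords \<longleftrightarrow> x \<in> ne_ZWords \<and> w \<in> ZWords"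
  using append_ZWords[of "[Letter a]" w] append_ZWords[of "[OmegaPow x q]" w]
    ZWords_iff[of "[OmegaPow x q]"]
  by (auto simp: ne_ZWords_def intro: ZWords.intros)

lemma replicate_Letter_ZWords [simp]: "replicate k (Letter a) \<in> ZWords"
  by (subst ZWords_iff) simp

lemma concat_ZWords: "(\<And>u. u \<in> set us \<Longrightarrow> u \<in> ZWords) \<Longrightarrow> concat us \<in> ZWords"
  by (induction us) auto

lemma ne_ZWords_append: "u \<in> ne_ZWords \<Longrightarrow> v \<in> ZWords \<Longrightarrow> u @ v \<in> ne_ZWords"
  "u \<in> ZWords \<Longrightarrow> v \<in> ne_ZWords \<Longrightarrow> u @ v \<in> ne_ZWords"
  by (auto simp: ne_ZWords_def)

lemma sword_eq_ZWords:
  "x \<approx> y \<Longrightarrow> x \<in> ZWords \<and> y \<in> ZWords \<and> (x = [] \<longleftrightarrow> y = [])"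
  by (induction rule: sword_rel.induct) (auto simp: ne_ZWords_def)

lemma sword_eq_context:
  "x \<approx> y \<Longrightarrow> u \<in> ZWords \<Longrightarrow> v \<in> ZWords \<Longrightarrow> u @ x @ v \<approx> u @ y @ v"
  by (intro sword_rel.concat sword_rel.refl)

lemma sword_eq_power: "x \<approx> y \<Longrightarrow> x \<noteq> [] \<Longrightarrow> [OmegaPow x q] \<approx> [OmegaPow y q]"
  using sword_rel.power sword_eq_ZWords by blast

text \<open>One unfolding on the left costs one in the exponent; then \<open>shift\<close> moves
  \<open>r\<close> across the power. With \<open>r\<close> empty \<open>shift\<close> does not
  apply, and the unfolding alone is the claim. This is what brings the last block of a base to its
  front.\<close>

lemma sword_eq_rotate:
  assumes "u \<in> ne_ZWords" "r \<in> ZWords"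
  shows "[OmegaPow (u @ r) q] \<approx> u @ [OmegaPow (r @ u) (q - 1)] @ r"
proof (cases "r = []")
  case True
  then show ?thesis using sword_rel.unfold_left[OF assms(1)] by simp
next
  case False
  then have r: "r \<in> ne_ZWords" using assms by (simp add: ne_ZWords_def)
  have "[OmegaPow (u @ r) q] \<approx> (u @ r) @ [OmegaPow (u @ r) (q - 1)]"
    by (intro sword_rel.unfold_left ne_ZWords_append assms)
  also have "(u @ r) @ [OmegaPow (u @ r) (q - 1)] = u @ (r @ [OmegaPow (u @ r) (q - 1)]) @ []"
    by simp
  also have "u @ (r @ [OmegaPow (u @ r) (q - 1)]) @ [] \<approx> u @ ([OmegaPow (r @ u) (q - 1)] @ r) @ []"
    using assms by (intro sword_eq_context sword_rel.shift r) (auto simp: ne_ZWords_def)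
  finally show ?thesis by simp
qed

lemma zstep_ne_ZWords: "zstep x y \<Longrightarrow> x \<in> ne_ZWords \<and> y \<in> ne_ZWords"
proof (induction rule: zstep.induct)
  case (rule \<sigma> \<tau>)
  then show ?case
  proof cases
    case (root x n q)
    then have "concat (replicate n x) \<in> ne_ZWords"
      by (cases n) (auto simp: ne_ZWords_def intro!: concat_ZWords)
    then show ?thesis using root by (simp add: ne_ZWords_def)
  qed (auto simp: ne_ZWords_def)
qed (auto simp: ne_ZWords_def)

section \<open>Reducible and irreducible words\<close>

definition reducible :: "'a zword \<Rightarrow> bool" where
  "reducible x \<longleftrightarrow> (\<exists>y z. x \<approx> y \<and> zstep y z)"

lemma reducible_sword_eq: "x \<approx> y \<Longrightarrow> reducible y \<Longrightarrow> reducible x"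
  unfolding reducible_def by (blast intro: sword_rel.trans)

lemma reducible_context:
  "reducible x \<Longrightarrow> u \<in> ZWords \<Longrightarrow> v \<in> ZWords \<Longrightarrow> reducible (u @ x @ v)"
  unfolding reducible_def by (blast intro: sword_eq_context zstep.subword)

lemma reducible_append:
  "reducible x \<Longrightarrow> v \<in> ZWords \<Longrightarrow> reducible (x @ v)"
  "reducible x \<Longrightarrow> u \<in> ZWords \<Longrightarrow> reducible (u @ x)"
  using reducible_context[of x "[]" v] reducible_context[of x u "[]"] by auto

lemma reducible_power: "reducible x \<Longrightarrow> reducible [OmegaPow x q]"
  unfolding reducible_def
  by (metis DiffD2 insertI1 ne_ZWords_def sword_eq_ZWords sword_eq_power zstep.power zstep_ne_ZWords)

lemma zrule_reducible: "zrule x y \<Longrightarrow> reducible x"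
  unfolding reducible_def using zstep.rule zstep_ne_ZWords
  by (metis DiffD1 ne_ZWords_def sword_rel.refl)

lemma normal_sword_irreducible:
  assumes "normal_sword \<sigma>" "x \<in> \<sigma>"
  shows "\<not> reducible x"
proof
  assume "reducible x"
  then obtain y z where yz: "x \<approx> y" "zstep y z" unfolding reducible_def by blast
  have \<sigma>: "\<sigma> \<in> ZWords // sword_rel" using assms unfolding normal_sword_def swords_def by blast
  then obtain w where w: "\<sigma> = sword_rel `` {w}" by (auto simp: quotient_def)
  have "y \<in> \<sigma>" using assms(2) yz(1) w by (auto intro: sword_rel.trans)
  moreover have z: "z \<in> ZWords" using zstep_ne_ZWords[OF yz(2)] by (simp add: ne_ZWords_def)
  then have "z \<in> sword_rel `` {z}" "sword_rel `` {z} \<in> swords"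
    by (auto simp: swords_def quotient_def intro: sword_rel.refl)
  ultimately have "sword_step \<sigma> (sword_rel `` {z})"
    using \<sigma> yz(2) unfolding sword_step_def swords_def by blast
  then show False using assms unfolding normal_sword_def by blast
qed

section \<open>Substitution and realization\<close>

primrec subst_zfactor :: "('a \<Rightarrow> 'b zword) \<Rightarrow> 'a zfactor \<Rightarrow> 'b zword" where
  "subst_zfactor f (Letter a) = f a"
| "subst_zfactor f (OmegaPow w q) = [OmegaPow (concat (map (subst_zfactor f) w)) q]"

definition subst :: "('a \<Rightarrow> 'b zword) \<Rightarrow> 'a zword \<Rightarrow> 'b zword" where
  "subst f w = concat (map (subst_zfactor f) w)"

lemma subst_simps [simp]:
  "subst f [] = []"
  "subst f (Letter a # w) = f a @ subst f w"
  "subst f (OmegaPow x q # w) = OmegaPow (subst f x) q # subst f w"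
  "subst f (u @ v) = subst f u @ subst f v"
  by (auto simp: subst_def)

lemma subst_concat_replicate: "subst f (concat (replicate n x)) = concat (replicate n (subst f x))"
  by (induction n) auto

lemma subst_ne_ZWords:
  assumes "\<And>a. f a \<in> ne_ZWords"
  shows "x \<in> ne_ZWords \<Longrightarrow> subst f x \<in> ne_ZWords"
proof -
  have f: "f a \<in> ZWords" "f a \<noteq> []" for a
    using assms[of a] by (auto simp: ne_ZWords_def)
  have "x \<in> ZWords \<Longrightarrow> subst f x \<in> ZWords \<and> (x \<noteq> [] \<longrightarrow> subst f x \<noteq> [])"
    by (induction rule: ZWords.induct) (auto simp: ne_ZWords_def f)
  then show "x \<in> ne_ZWords \<Longrightarrow> subst f x \<in> ne_ZWords" by (simp add: ne_ZWords_def)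
qed

lemma subst_ZWords: "(\<And>a. f a \<in> ne_ZWords) \<Longrightarrow> x \<in> ZWords \<Longrightarrow> subst f x \<in> ZWords"
  using subst_ne_ZWords[of f x] by (cases "x = []") (auto simp: ne_ZWords_def)

lemma subst_sword_eq:
  assumes f: "\<And>a. f a \<in> ne_ZWords"
  shows "x \<approx> y \<Longrightarrow> subst f x \<approx> subst f y"
proof (induction rule: sword_rel.induct)
  case (refl \<sigma>)
  then show ?case by (intro sword_rel.refl subst_ZWords f)
next
  case (sym \<sigma> \<tau>)
  show ?case by (rule sword_rel.sym[OF sym.IH])
next
  case (trans \<sigma> \<tau> \<rho>)
  then show ?case by (blast intro: sword_rel.trans)
next
  case (concat \<sigma> \<sigma>' \<tau> \<tau>')
  then show ?case by (simp add: sword_rel.concat)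
next
  case (power \<sigma> \<tau> q)
  then have "subst f \<sigma> \<noteq> []"
    using subst_ne_ZWords[of f \<sigma>] f sword_eq_ZWords[of \<sigma> \<tau>] by (auto simp: ne_ZWords_def)
  then show ?case using power by (simp add: sword_eq_power)
next
  case (unfold_left x q)
  then show ?case using sword_rel.unfold_left[of "subst f x"] subst_ne_ZWords f by fastforce
next
  case (unfold_right x q)
  then show ?case using sword_rel.unfold_right[of "subst f x"] subst_ne_ZWords f by fastforce
next
  case (shift x y q)
  then show ?case
    using sword_rel.shift[of "subst f x" "subst f y"] subst_ne_ZWords f by fastforce
qed

lemma subst_zstep:
  assumes f: "\<And>a. f a \<in> ne_ZWords"
  shows "zstep x y \<Longrightarrow> zstep (subst f x) (subst f y)"
proof (induction rule: zstep.induct)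
  case (rule \<sigma> \<tau>)
  then have "zrule (subst f \<sigma>) (subst f \<tau>)"
    by cases (auto simp: subst_concat_replicate intro!: zrule.intros subst_ne_ZWords f)
  then show ?case by (rule zstep.rule)
next
  case (subword \<sigma> \<tau> \<pi> \<rho>)
  then show ?case by (simp add: zstep.subword subst_ZWords f)
next
  case (power \<sigma> \<tau> q)
  then show ?case by (simp add: zstep.power)
qed

text \<open>Used in the contrapositive: a word is irreducible as soon as its image under such a
  substitution is.\<close>

lemma reducible_subst:
  "(\<And>a. f a \<in> ne_ZWords) \<Longrightarrow> reducible x \<Longrightarrow> reducible (subst f x)"
  unfolding reducible_def using subst_sword_eq subst_zstep by blast

section \<open>Letters of a word and realizations of omega by a number\<close>

definition letters :: "'a zword \<Rightarrow> 'a set" where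
  "letters w = (\<Union>f\<in>set w. set_zfactor f)"

lemma letters_simps [simp]:
  "letters [] = {}"
  "letters (Letter a # w) = insert a (letters w)"
  "letters (OmegaPow x q # w) = letters x \<union> letters w"
  "letters (u @ v) = letters u \<union> letters v"
  by (auto simp: letters_def)

lemma finite_letters [simp]: "finite (letters w)"
proof -
  have "finite (set_zfactor f)" for f :: "'a zfactor"
    by (induction f) auto
  then show ?thesis by (simp add: letters_def)
qed

text \<open>Reads omega as \<open>N\<close>. If \<open>N + q\<close> is negative, \<open>nat\<close>
  truncates it to 0; this is why sword-equal words have equal realizations only for large
  \<open>N\<close>.\<close>

primrec realize_zfactor :: "nat \<Rightarrow> 'a zfactor \<Rightarrow> 'a list" where
  "realize_zfactor N (Letter a) = [a]"
| "realize_zfactor N (OmegaPow w q) =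
    concat (replicate (nat (int N + q)) (concat (map (realize_zfactor N) w)))"

definition realize :: "nat \<Rightarrow> 'a zword \<Rightarrow> 'a list" where
  "realize N w = concat (map (realize_zfactor N) w)"

lemma realize_simps [simp]:
  "realize N [] = []"
  "realize N (Letter a # w) = a # realize N w"
  "realize N (OmegaPow x q # w) =
    concat (replicate (nat (int N + q)) (realize N x)) @ realize N w"
  "realize N (u @ v) = realize N u @ realize N v"
  by (auto simp: realize_def)

text \<open>Flattens the induction over the nested datatype: a word that starts with a power comes
  with hypotheses for the base and for the remaining word at once.\<close>

lemma word_induct [case_names Nil Letter OmegaPow]:
  fixes P :: "'a zword \<Rightarrow> bool"
  assumes "P []" "\<And>a w. P w \<Longrightarrow> P (Letter a # w)"
    "\<And>x q w. P x \<Longrightarrow> P w \<Longrightarrow> P (OmegaPow x q # w)"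
  shows "P w"
proof -
  have list: "(\<And>f w. f \<in> set v \<Longrightarrow> P w \<Longrightarrow> P (f # w)) \<Longrightarrow> P v" for v
    using assms(1) by (induction v) auto
  have "P w \<Longrightarrow> P (f # w)" for f w
  proof (induction f arbitrary: w)
    case (OmegaPow x q)
    then show ?case using assms(3) list by blast
  qed (use assms(2) in blast)
  then show ?thesis using list by blast
qed

lemma set_realize: "set (realize N w) \<subseteq> letters w"
  by (induction w rule: word_induct) auto

lemma realize_subst:
  "realize N (subst f w) = concat (map (\<lambda>a. realize N (f a)) (realize N w))"
proof (induction w rule: word_induct)
  case (OmegaPow x q w)
  have "concat (map g (concat (replicate n u))) = concat (replicate n (concat (map g u)))"
    for g :: "'b \<Rightarrow> 'a list" and n u by (induction n) auto
  then show ?case using OmegaPow by simp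
qed auto

lemma sword_eq_realize: "x \<approx> y \<Longrightarrow> \<exists>N0. \<forall>N\<ge>N0. realize N x = realize N y"
proof (induction rule: sword_rel.induct)
  case (sym \<sigma> \<tau>)
  from sym.IH show ?case by metis
next
  case (power \<sigma> \<tau> q)
  from power.IH show ?case by fastforce
next
  case (trans \<sigma> \<tau> \<rho>)
  then obtain N1 N2 where "\<forall>N\<ge>N1. realize N \<sigma> = realize N \<tau>" "\<forall>N\<ge>N2. realize N \<tau> = realize N \<rho>"
    by blast
  then show ?case by (intro exI[of _ "max N1 N2"]) auto
next
  case (concat \<sigma> \<sigma>' \<tau> \<tau>')
  then obtain N1 N2 where "\<forall>N\<ge>N1. realize N \<sigma> = realize N \<sigma>'" "\<forall>N\<ge>N2. realize N \<tau> = realize N \<tau>'"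
    by blast
  then show ?case by (intro exI[of _ "max N1 N2"]) auto
next
  case (unfold_left x q)
  \<comment> \<open>From \<open>nat (1 - q)\<close> on, \<open>N + q - 1\<close> is not negative, so
    the truncation does not interfere with the unfolding.\<close>
  have "nat (int N + q) = Suc (nat (int N + (q - 1)))" if "N \<ge> nat (1 - q)" for N
    using that by linarith
  then show ?case by (intro exI[of _ "nat (1 - q)"]) simp
next
  case (unfold_right x q)
  have "nat (int N + q) = Suc (nat (int N + (q - 1)))" if "N \<ge> nat (1 - q)" for N
    using that by linarith
  moreover have "concat (replicate (Suc n) u) = concat (replicate n u) @ u" for n and u :: "'a list"
    by (induction n) auto
  ultimately show ?case by (intro exI[of _ "nat (1 - q)"]) (simp del: replicate_Suc)
next
  case (shift x y q)
  have "u @ concat (replicate n (v @ u)) = concat (replicate n (u @ v)) @ u" for n and u v :: "'a list"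
    by (induction n) auto
  then show ?case by simp
qed auto

section \<open>Elimination of a letter\<close>

definition plain :: "'a zword \<Rightarrow> bool" where
  "plain w \<longleftrightarrow> (\<forall>x q. OmegaPow x q \<notin> set w)"

lemma plain_simps [simp]:
  "plain []" "plain (Letter a # w) \<longleftrightarrow> plain w" "\<not> plain (OmegaPow x q # w)"
  "plain (u @ v) \<longleftrightarrow> plain u \<and> plain v" "plain (replicate k (Letter a))"
  by (auto simp: plain_def)

text \<open>\<open>C\<close> holds the letters still allowed in bases of the maximal length
  \<open>l\<close>. With \<open>C\<close> empty a non-empty base has to be shorter than
  \<open>l\<close>, and for \<open>l = 0\<close> no non-empty base is small.\<close>

definition small_base :: "nat \<Rightarrow> 'a set \<Rightarrow> 'a zword \<Rightarrow> bool" where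
  "small_base l C x \<longleftrightarrow> plain x \<and> length x \<le> l \<and> (length x = l \<longrightarrow> letters x \<subseteq> C)"

text \<open>The elimination argument is an induction on \<open>(k, l, card C)\<close>: eliminating \<open>a \<in> C\<close> leaves no base
  of length \<open>l\<close> containing \<open>a\<close>. The index \<open>k\<close> bounds the nesting depth of powers above the bases that
  are being shortened.\<close>

primrec bounded :: "nat \<Rightarrow> 'a set \<Rightarrow> nat \<Rightarrow> 'a zword \<Rightarrow> bool" where
  "bounded l C 0 w \<longleftrightarrow> (\<forall>x q. OmegaPow x q \<in> set w \<longrightarrow> small_base l C x)"
| "bounded l C (Suc k) w \<longleftrightarrow>
    (\<forall>x q. OmegaPow x q \<in> set w \<longrightarrow> small_base l C x \<or> bounded l C k x)"

lemma bounded_append [simp]: "bounded l C k (u @ v) \<longleftrightarrow> bounded l C k u \<and> bounded l C k v"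
  by (cases k) auto

lemma bounded_plain: "plain w \<Longrightarrow> bounded l C k w"
  by (cases k) (auto simp: plain_def)

lemma bounded_Letter [simp]: "bounded l C k (Letter a # w) \<longleftrightarrow> bounded l C k w"
  by (cases k) auto

lemma bounded_Suc: "bounded l C k w \<Longrightarrow> bounded l C (Suc k) w"
proof (induction k arbitrary: w)
  case (Suc k)
  then show ?case unfolding bounded.simps(2)[of l C k w] by (subst bounded.simps) blast
qed simp

section \<open>Blocks of a letter and letters carrying a block\<close>

datatype block = Fin nat | Om int

text \<open>Allows pairs of a block and a letter to be numbered, so that old and new letters share
  the type \<open>nat\<close> and eliminations can be iterated.\<close>

instance block :: countable
  by countable_datatype

primrec block_word :: "'a \<Rightarrow> block \<Rightarrow> 'a zword" where
  "block_word a (Fin k) = replicate k (Letter a)"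
| "block_word a (Om q) = [OmegaPow [Letter a] q]"

fun block_add :: "block \<Rightarrow> block \<Rightarrow> block" where
  "block_add (Fin i) (Fin j) = Fin (i + j)"
| "block_add (Fin i) (Om q) = Om (q + int i)"
| "block_add (Om q) (Fin i) = Om (q + int i)"
| "block_add (Om q) (Om r) = Om (q + r)"

lemma block_word_ZWords [simp]: "block_word a M \<in> ZWords"
  by (cases M) (auto simp: ne_ZWords_def)

lemma sword_eq_block_left:
  "replicate k (Letter a) @ [OmegaPow [Letter a] q] \<approx> [OmegaPow [Letter a] (q + int k)]"
proof (induction k)
  case 0
  then show ?case by (simp add: sword_rel.refl ne_ZWords_def)
next
  case (Suc k)
  have "replicate (Suc k) (Letter a) @ [OmegaPow [Letter a] q]
    \<approx> [Letter a] @ [OmegaPow [Letter a] (q + int k)]"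
    using sword_rel.concat[OF sword_rel.refl[of "[Letter a]"] Suc] by simp
  also have "[Letter a] @ [OmegaPow [Letter a] (q + int k)]
    \<approx> [OmegaPow [Letter a] (q + int (Suc k))]"
    using sword_rel.unfold_left[of "[Letter a]" "q + int (Suc k)", THEN sword_rel.sym]
    by (simp add: ne_ZWords_def add.commute)
  finally show ?case .
qed

lemma sword_eq_block_right:
  "[OmegaPow [Letter a] q] @ replicate k (Letter a) \<approx> [OmegaPow [Letter a] (q + int k)]"
proof (induction k)
  case 0
  then show ?case by (simp add: sword_rel.refl ne_ZWords_def)
next
  case (Suc k)
  have "[OmegaPow [Letter a] q] @ replicate (Suc k) (Letter a)
    = ([OmegaPow [Letter a] q] @ replicate k (Letter a)) @ [Letter a]"
    by (simp add: replicate_append_same)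
  also have "([OmegaPow [Letter a] q] @ replicate k (Letter a)) @ [Letter a]
    \<approx> [OmegaPow [Letter a] (q + int k)] @ [Letter a]"
    by (intro sword_rel.concat Suc sword_rel.refl) simp
  also have "[OmegaPow [Letter a] (q + int k)] @ [Letter a]
    \<approx> [OmegaPow [Letter a] (q + int (Suc k))]"
    using sword_rel.unfold_right[of "[Letter a]" "q + int (Suc k)", THEN sword_rel.sym]
    by (simp add: ne_ZWords_def add.commute)
  finally show ?case .
qed

text \<open>Unfolding lets a finite block and an omega-block merge. Two omega-blocks are not merged
  by the sword relation; they are a redex of the rule \<open>add\<close>.\<close>

lemma block_word_add:
  "reducible (block_word a M @ block_word a M') \<or>
    block_word a M @ block_word a M' \<approx> block_word a (block_add M M')"
proof (cases M; cases M')
  fix q r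
  assume "M = Om q" "M' = Om r"
  then show ?thesis
    using zrule_reducible[OF zrule.add[of "[Letter a]" q r]] by (simp add: ne_ZWords_def)
next
  fix q j
  assume "M = Om q" "M' = Fin j"
  then show ?thesis using sword_eq_block_right[of a q j] by simp
qed (auto simp: replicate_add intro: sword_rel.refl sword_eq_block_left)

lemma irreducible_block_add:
  assumes x: "x \<approx> u @ (block_word a M @ block_word a M') @ v" and "\<not> reducible x"
    and uv: "u \<in> ZWords" "v \<in> ZWords"
  shows "x \<approx> u @ block_word a (block_add M M') @ v"
proof -
  have "\<not> reducible (block_word a M @ block_word a M')"
    using reducible_context[OF _ uv, of "block_word a M @ block_word a M'"]
      reducible_sword_eq[OF x] assms(2) by blast
  then have "block_word a M @ block_word a M' \<approx> block_word a (block_add M M')"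
    using block_word_add[of a M M'] by blast
  then show ?thesis by (rule sword_rel.trans[OF x sword_eq_context[OF _ uv]])
qed

text \<open>New letters stand for a block followed by an old letter other than the eliminated one. Old
  letters are the numbers below \<open>B\<close>, and an old letter preceded by the empty block keeps its name.\<close>

definition block_code :: "nat \<Rightarrow> block \<Rightarrow> nat \<Rightarrow> nat" where
  "block_code B M d = (if M = Fin 0 then d else B + to_nat (M, d))"

definition block_decode :: "nat \<Rightarrow> nat \<Rightarrow> block \<times> nat" where
  "block_decode B l = (if l < B then (Fin 0, l) else from_nat (l - B))"

lemma block_decode_code [simp]: "d < B \<Longrightarrow> block_decode B (block_code B M d) = (M, d)"
  by (auto simp: block_decode_def block_code_def)

lemma block_code_Fin_0 [simp]: "block_code B (Fin 0) d = d"
  by (simp add: block_code_def)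

definition new_letters :: "nat \<Rightarrow> nat \<Rightarrow> nat set" where
  "new_letters a B = {block_code B M d | M d. d \<noteq> a \<and> d < B}"

definition expand :: "nat \<Rightarrow> nat \<Rightarrow> nat \<Rightarrow> nat zword" where
  "expand a B l = (case block_decode B l of (M, d) \<Rightarrow> block_word a M @ [Letter d])"

lemma expand_ne_ZWords: "expand a B l \<in> ne_ZWords"
  by (auto simp: expand_def ne_ZWords_def split: prod.split)

lemma expand_block_code [simp]: "d < B \<Longrightarrow> expand a B (block_code B M d) = block_word a M @ [Letter d]"
  by (simp add: expand_def)

text \<open>The case of a word without letters other than \<open>a\<close>. The clause on plain
  words feeds the length count when such a word is concatenated with another one.\<close>

definition block_form :: "nat \<Rightarrow> nat zword \<Rightarrow> bool" where
  "block_form a x \<longleftrightarrow> (\<exists>R. x \<approx> block_word a R \<and>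
    (plain x \<longrightarrow> R \<in> range Fin \<and> (a \<notin> letters x \<longrightarrow> R = Fin 0)))"

text \<open>The first letter \<open>d\<close> is kept separate, since the block before it can still grow to the left.\<close>

definition letter_rep ::
  "nat \<Rightarrow> nat \<Rightarrow> nat \<Rightarrow> nat set \<Rightarrow> nat zword \<Rightarrow> block \<Rightarrow> nat \<Rightarrow> nat zword \<Rightarrow> block \<Rightarrow> bool" where
  "letter_rep a B l C x L d y R \<longleftrightarrow>
    x \<approx> block_word a L @ [Letter d] @ subst (expand a B) y @ block_word a R \<and>
    d \<noteq> a \<and> d < B \<and> y \<in> ZWords \<and> letters y \<subseteq> new_letters a B \<and>
    (plain x \<longrightarrow> plain y \<and> L \<in> range Fin \<and> R \<in> range Fin \<and> length y < length x \<and>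
      (a \<in> letters x \<longrightarrow> Suc (length y) < length x) \<and>
      (a \<notin> letters x \<longrightarrow> L = Fin 0 \<and> R = Fin 0 \<and> insert d (letters y) \<subseteq> letters x)) \<and>
    (\<forall>k. bounded l C k x \<longrightarrow> bounded l (C - {a}) k y)"

definition letter_form :: "nat \<Rightarrow> nat \<Rightarrow> nat \<Rightarrow> nat set \<Rightarrow> nat zword \<Rightarrow> bool" where
  "letter_form a B l C x \<longleftrightarrow> (\<exists>L d y R. letter_rep a B l C x L d y R)"

lemma letter_repD:
  assumes "letter_rep a B l C x L d y R"
  shows "x \<approx> block_word a L @ [Letter d] @ subst (expand a B) y @ block_word a R"
    and "d \<noteq> a" "d < B"
    and "y \<in> ZWords" "letters y \<subseteq> new_letters a B"
    and "plain x \<Longrightarrow> plain y \<and> L \<in> range Fin \<and> R \<in> range Fin \<and> length y < length x \<and>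
      (a \<in> letters x \<longrightarrow> Suc (length y) < length x) \<and>
      (a \<notin> letters x \<longrightarrow> L = Fin 0 \<and> R = Fin 0 \<and> insert d (letters y) \<subseteq> letters x)"
    and "bounded l C k x \<Longrightarrow> bounded l (C - {a}) k y"
  using assms unfolding letter_rep_def by simp_all

lemma letters_nonempty: "a \<in> letters x \<Longrightarrow> 0 < length x"
  by (cases x) auto

lemma range_Fin_add: "M \<in> range Fin \<Longrightarrow> M' \<in> range Fin \<Longrightarrow> block_add M M' \<in> range Fin"
  by auto

context
  fixes a B l :: nat and C :: "nat set"
begin

text \<open>A base that is an omega-block is a redex of \<open>nest\<close>, a base
  \<open>Fin k\<close> with \<open>k \<ge> 2\<close> is one of \<open>root\<close>, and
  \<open>k = 0\<close> is excluded since \<open>x\<close> is non-empty. Only the base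
  \<open>a\<close> itself remains, whose powers are blocks.\<close>

lemma forms_power_block:
  assumes x: "x \<in> ZWords" "x \<noteq> []" and form: "block_form a x"
  shows "reducible [OmegaPow x q] \<or> block_form a [OmegaPow x q]"
proof -
  obtain R where R: "x \<approx> block_word a R" using form unfolding block_form_def by blast
  have eq: "[OmegaPow x q] \<approx> [OmegaPow (block_word a R) q]"
    by (intro sword_eq_power R x)
  show ?thesis
  proof (cases R)
    case (Om r)
    have "reducible [OmegaPow (block_word a R) q]"
      unfolding Om using zrule_reducible[OF zrule.nest[of "[Letter a]" r q]]
      by (simp add: ne_ZWords_def)
    then show ?thesis using eq reducible_sword_eq by blast
  next
    case (Fin k)
    have "k \<noteq> 0" using R x sword_eq_ZWords[OF R] Fin by auto
    moreover have "reducible [OmegaPow x q]" if "k \<ge> 2"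
    proof -
      have "concat (replicate k [Letter a]) = replicate k (Letter a)" by (induction k) auto
      then have "reducible [OmegaPow (block_word a R) q]"
        unfolding Fin using zrule_reducible[OF zrule.root[of "[Letter a]" k q]] that
        by (simp add: ne_ZWords_def)
      then show ?thesis using eq reducible_sword_eq by blast
    qed
    moreover have "block_form a [OmegaPow x q]" if "k = 1"
      using eq that Fin unfolding block_form_def by (intro exI[of _ "Om q"]) simp
    ultimately show ?thesis by (cases "k = 1") auto
  qed
qed

text \<open>After rotation the base starts with its former last block \<open>R\<close> followed by
  \<open>L\<close>. The two merge in front of \<open>d\<close>, so the rotated base consists
  entirely of new letters. The unrolled copy supplies the outer \<open>L\<close>, \<open>d\<close>
  and \<open>R\<close> again.\<close>

lemma forms_power_letter:
  assumes x: "x \<in> ZWords" "x \<noteq> []" and form: "letter_form a B l C x"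
  shows "reducible [OmegaPow x q] \<or> letter_form a B l C [OmegaPow x q]"
proof -
  obtain L d y R where rep: "letter_rep a B l C x L d y R"
    using form unfolding letter_form_def by blast
  note eq = letter_repD(1)[OF rep] and d = letter_repD(2,3)[OF rep]
    and y = letter_repD(4,5)[OF rep] and pl = letter_repD(6)[OF rep]
    and bd = letter_repD(7)[OF rep]
  define u where "u = block_word a L @ [Letter d] @ subst (expand a B) y"
  define r where "r = block_word a R"
  have y': "subst (expand a B) y \<in> ZWords" by (intro subst_ZWords expand_ne_ZWords y)
  have u: "u \<in> ne_ZWords" and r: "r \<in> ZWords"
    using y' by (auto simp: u_def r_def ne_ZWords_def)
  have eq1: "[OmegaPow x q] \<approx> u @ [OmegaPow (r @ u) (q - 1)] @ r"
  proof -
    have "[OmegaPow x q] \<approx> [OmegaPow (u @ r) q]"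
      using sword_eq_power[OF eq x(2)] by (simp add: u_def r_def)
    also have "[OmegaPow (u @ r) q] \<approx> u @ [OmegaPow (r @ u) (q - 1)] @ r"
      by (rule sword_eq_rotate[OF u r])
    finally show ?thesis .
  qed
  show ?thesis
  \<comment> \<open>\<open>R\<close> and \<open>L\<close> sit at opposite ends of \<open>x\<close>,
    so a redex formed by them may be invisible in \<open>x\<close> itself; it shows up in the
    rotated base and makes the power reducible.\<close>
  proof (cases "reducible (block_word a R @ block_word a L)")
    case True
    then have "reducible (r @ u)"
      using reducible_append(1)[OF True, of "[Letter d] @ subst (expand a B) y"] y'
      by (simp add: r_def u_def)
    then have "reducible (u @ [OmegaPow (r @ u) (q - 1)] @ r)"
      using u r by (intro reducible_context reducible_power) (auto simp: ne_ZWords_def)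
    then show ?thesis using eq1 reducible_sword_eq by blast
  next
    case False
    \<comment> \<open>The blocks at both ends of the base cost only one new letter, the one that
      also absorbs \<open>d\<close>.\<close>
    define z where "z = Letter (block_code B (block_add R L) d) # y"
    have z: "z \<in> ne_ZWords"
      using y by (simp add: z_def ne_ZWords_def)
    have "[] @ (block_word a R @ block_word a L) @ ([Letter d] @ subst (expand a B) y)
      \<approx> [] @ block_word a (block_add R L) @ ([Letter d] @ subst (expand a B) y)"
      using False block_word_add[of a R L] y'
      by (intro sword_eq_context) auto
    then have "r @ u \<approx> subst (expand a B) z" using d by (simp add: z_def r_def u_def)
    then have "[OmegaPow (r @ u) (q - 1)] \<approx> [OmegaPow (subst (expand a B) z) (q - 1)]"
      using u by (intro sword_eq_power) (auto simp: ne_ZWords_def)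
    then have "u @ [OmegaPow (r @ u) (q - 1)] @ r
      \<approx> u @ [OmegaPow (subst (expand a B) z) (q - 1)] @ r"
      using u r by (intro sword_eq_context) (auto simp: ne_ZWords_def)
    with eq1 have "[OmegaPow x q] \<approx> u @ [OmegaPow (subst (expand a B) z) (q - 1)] @ r"
      by (rule sword_rel.trans)
    then have "[OmegaPow x q] \<approx> block_word a L @ [Letter d] @
        subst (expand a B) (y @ [OmegaPow z (q - 1)]) @ block_word a R"
      by (simp add: u_def r_def)
    moreover have "letters (y @ [OmegaPow z (q - 1)]) \<subseteq> new_letters a B"
      using y d by (auto simp: z_def new_letters_def)
    \<comment> \<open>The length of \<open>z\<close> is \<open>Suc (length y)\<close>, which is
      below \<open>length x\<close> if \<open>a\<close> occurs in \<open>x\<close>. Otherwise both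
      outer blocks are empty, \<open>d\<close> keeps its name, and all letters of \<open>z\<close>
      are letters of \<open>x\<close> other than \<open>a\<close>.\<close>
    moreover have small: "small_base l (C - {a}) z" if "small_base l C x"
      using that pl unfolding small_base_def z_def by auto
    have "bounded l (C - {a}) k (y @ [OmegaPow z (q - 1)])"
      if bk: "bounded l C k [OmegaPow x q]" for k
    proof (cases "small_base l C x")
      case True
      then have "bounded l (C - {a}) k y" using pl by (simp add: small_base_def bounded_plain)
      moreover have "bounded l (C - {a}) k [OmegaPow z (q - 1)]"
        using small[OF True] by (cases k) simp_all
      ultimately show ?thesis by simp
    next
      case False
      then obtain k' where k: "k = Suc k'" "bounded l C k' x" using bk by (cases k) auto
      then have "bounded l (C - {a}) k' z" using bd by (simp add: z_def)
      \<comment> \<open>The unrolled copy \<open>y\<close> leaves the base and stands one level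
        higher, so it must satisfy the weaker bound for \<open>Suc k'\<close>.\<close>
      moreover have "bounded l (C - {a}) k y" using k bd bounded_Suc by blast
      ultimately show ?thesis using k by simp
    qed
    ultimately have "letter_form a B l C [OmegaPow x q]"
      unfolding letter_form_def letter_rep_def using d y z
      by (intro exI[of _ L] exI[of _ d] exI[of _ "y @ [OmegaPow z (q - 1)]"] exI[of _ R]) simp
    then show ?thesis ..
  qed
qed

text \<open>Only the seam matters, where the last block of \<open>x1\<close> meets the first block
  of \<open>x2\<close>; irreducibility lets them merge. With other letters on both sides, the merged
  block turns the first letter \<open>d2\<close> of \<open>x2\<close> into a new letter; otherwise
  it becomes an outer block.\<close>

lemma forms_concat:
  assumes x1: "block_form a x1 \<or> letter_form a B l C x1"
    and x2: "block_form a x2 \<or> letter_form a B l C x2"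
    and irred: "\<not> reducible (x1 @ x2)"
  shows "block_form a (x1 @ x2) \<or> letter_form a B l C (x1 @ x2)"
proof -
  consider (bb) "block_form a x1" "block_form a x2" | (bl) "block_form a x1" "letter_form a B l C x2"
    | (lb) "letter_form a B l C x1" "block_form a x2"
    | (ll) "letter_form a B l C x1" "letter_form a B l C x2"
      using x1 x2 by blast
  then show ?thesis
  proof cases
    case bb
    then obtain R1 R2 where eq: "x1 \<approx> block_word a R1" "x2 \<approx> block_word a R2" and
      pl: "plain x1 \<Longrightarrow> R1 \<in> range Fin \<and> (a \<notin> letters x1 \<longrightarrow> R1 = Fin 0)"
      "plain x2 \<Longrightarrow> R2 \<in> range Fin \<and> (a \<notin> letters x2 \<longrightarrow> R2 = Fin 0)"
      unfolding block_form_def by blast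
    have eq': "x1 @ x2 \<approx> block_word a R1 @ block_word a R2" by (intro sword_rel.concat eq)
    have "x1 @ x2 \<approx> block_word a (block_add R1 R2)"
      using irreducible_block_add[of "x1 @ x2" "[]" a R1 R2 "[]"] eq' irred by simp
    moreover have "plain (x1 @ x2) \<longrightarrow> block_add R1 R2 \<in> range Fin \<and>
        (a \<notin> letters (x1 @ x2) \<longrightarrow> block_add R1 R2 = Fin 0)"
      using pl range_Fin_add by auto
    ultimately show ?thesis unfolding block_form_def by blast
  next
    case bl
    then obtain R1 where eq1: "x1 \<approx> block_word a R1" and
      pl1: "plain x1 \<Longrightarrow> R1 \<in> range Fin \<and> (a \<notin> letters x1 \<longrightarrow> R1 = Fin 0)"
      unfolding block_form_def by blast
    obtain L d y R where rep: "letter_rep a B l C x2 L d y R"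
      using bl(2) unfolding letter_form_def by blast
    note eq = letter_repD(1)[OF rep] and d = letter_repD(2,3)[OF rep]
      and y = letter_repD(4,5)[OF rep] and pl = letter_repD(6)[OF rep]
      and bd = letter_repD(7)[OF rep]
    define t where "t = [Letter d] @ subst (expand a B) y @ block_word a R"
    have t: "t \<in> ZWords" using subst_ZWords[OF expand_ne_ZWords y(1)] by (simp add: t_def)
    have eq': "x1 @ x2 \<approx> [] @ (block_word a R1 @ block_word a L) @ t"
      using sword_rel.concat[OF eq1 eq] by (simp add: t_def)
    have "x1 @ x2 \<approx> [] @ block_word a (block_add R1 L) @ t"
      by (rule irreducible_block_add[OF eq' irred Nil_ZWords t])
    \<comment> \<open>\<open>x1\<close> contributes no letter to \<open>y\<close>; if
      \<open>a\<close> occurs in it, its length is positive, which gives the strict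
      inequality.\<close>
    moreover have "plain (x1 @ x2) \<longrightarrow> plain y \<and> block_add R1 L \<in> range Fin \<and> R \<in> range Fin \<and>
        length y < length (x1 @ x2) \<and>
        (a \<in> letters (x1 @ x2) \<longrightarrow> Suc (length y) < length (x1 @ x2)) \<and>
        (a \<notin> letters (x1 @ x2) \<longrightarrow> block_add R1 L = Fin 0 \<and> R = Fin 0 \<and>
          insert d (letters y) \<subseteq> letters (x1 @ x2))"
      using pl1 pl range_Fin_add[of R1 L] letters_nonempty[of a x1]
      by (auto simp del: length_greater_0_conv)
    ultimately have "letter_form a B l C (x1 @ x2)"
      unfolding letter_form_def letter_rep_def t_def using d y bd
      by (intro exI[of _ "block_add R1 L"] exI[of _ d] exI[of _ y] exI[of _ R]) simp
    then show ?thesis by blast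
  next
    case lb
    then obtain R2 where eq2: "x2 \<approx> block_word a R2" and
      pl2: "plain x2 \<Longrightarrow> R2 \<in> range Fin \<and> (a \<notin> letters x2 \<longrightarrow> R2 = Fin 0)"
      unfolding block_form_def by blast
    obtain L d y R where rep: "letter_rep a B l C x1 L d y R"
      using lb(1) unfolding letter_form_def by blast
    note eq = letter_repD(1)[OF rep] and d = letter_repD(2,3)[OF rep]
      and y = letter_repD(4,5)[OF rep] and pl = letter_repD(6)[OF rep]
      and bd = letter_repD(7)[OF rep]
    define t where "t = block_word a L @ [Letter d] @ subst (expand a B) y"
    have t: "t \<in> ZWords" using subst_ZWords[OF expand_ne_ZWords y(1)] by (simp add: t_def)
    have eq': "x1 @ x2 \<approx> t @ (block_word a R @ block_word a R2) @ []"
      using sword_rel.concat[OF eq eq2] by (simp add: t_def)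
    have "x1 @ x2 \<approx> t @ block_word a (block_add R R2) @ []"
      by (rule irreducible_block_add[OF eq' irred t Nil_ZWords])
    moreover have "plain (x1 @ x2) \<longrightarrow> plain y \<and> L \<in> range Fin \<and> block_add R R2 \<in> range Fin \<and>
        length y < length (x1 @ x2) \<and>
        (a \<in> letters (x1 @ x2) \<longrightarrow> Suc (length y) < length (x1 @ x2)) \<and>
        (a \<notin> letters (x1 @ x2) \<longrightarrow> L = Fin 0 \<and> block_add R R2 = Fin 0 \<and>
          insert d (letters y) \<subseteq> letters (x1 @ x2))"
      using pl2 pl range_Fin_add[of R R2] letters_nonempty[of a x2]
      by (auto simp del: length_greater_0_conv)
    ultimately have "letter_form a B l C (x1 @ x2)"
      unfolding letter_form_def letter_rep_def t_def using d y bd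
      by (intro exI[of _ L] exI[of _ d] exI[of _ y] exI[of _ "block_add R R2"]) simp
    then show ?thesis by blast
  next
    case ll
    obtain L1 d1 y1 R1 where rep1: "letter_rep a B l C x1 L1 d1 y1 R1"
      using ll(1) unfolding letter_form_def by blast
    note eq1 = letter_repD(1)[OF rep1] and d1 = letter_repD(2,3)[OF rep1]
      and y1 = letter_repD(4,5)[OF rep1] and pl1 = letter_repD(6)[OF rep1]
      and bd1 = letter_repD(7)[OF rep1]
    obtain L2 d2 y2 R2 where rep2: "letter_rep a B l C x2 L2 d2 y2 R2"
      using ll(2) unfolding letter_form_def by blast
    note eq2 = letter_repD(1)[OF rep2] and d2 = letter_repD(2,3)[OF rep2]
      and y2 = letter_repD(4,5)[OF rep2] and pl2 = letter_repD(6)[OF rep2]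
      and bd2 = letter_repD(7)[OF rep2]
    define s where "s = block_word a L1 @ [Letter d1] @ subst (expand a B) y1"
    define t where "t = [Letter d2] @ subst (expand a B) y2 @ block_word a R2"
    have s: "s \<in> ZWords" using subst_ZWords[OF expand_ne_ZWords y1(1)] by (simp add: s_def)
    have t: "t \<in> ZWords" using subst_ZWords[OF expand_ne_ZWords y2(1)] by (simp add: t_def)
    have eq': "x1 @ x2 \<approx> s @ (block_word a R1 @ block_word a L2) @ t"
      using sword_rel.concat[OF eq1 eq2] by (simp add: s_def t_def)
    define z where "z = y1 @ [Letter (block_code B (block_add R1 L2) d2)] @ y2"
    have "x1 @ x2 \<approx> s @ block_word a (block_add R1 L2) @ t"
      by (rule irreducible_block_add[OF eq' irred s t])
    then have "x1 @ x2 \<approx> block_word a L1 @ [Letter d1] @ subst (expand a B) z @ block_word a R2"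
      using d2 by (simp add: s_def t_def z_def)
    moreover have "plain (x1 @ x2) \<longrightarrow> plain z \<and> L1 \<in> range Fin \<and> R2 \<in> range Fin \<and>
        length z < length (x1 @ x2) \<and>
        (a \<in> letters (x1 @ x2) \<longrightarrow> Suc (length z) < length (x1 @ x2)) \<and>
        (a \<notin> letters (x1 @ x2) \<longrightarrow> L1 = Fin 0 \<and> R2 = Fin 0 \<and>
          insert d1 (letters z) \<subseteq> letters (x1 @ x2))"
      using pl1 pl2 by (auto simp: z_def)
    ultimately have "letter_form a B l C (x1 @ x2)"
      unfolding letter_form_def letter_rep_def using d1 d2 y1 y2 bd1 bd2
      by (intro exI[of _ L1] exI[of _ d1] exI[of _ z] exI[of _ R2]) (auto simp: z_def new_letters_def)
    then show ?thesis by blast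
  qed
qed

lemma letter_elimination_forms:
  assumes "x \<in> ZWords" "letters x \<subseteq> {..<B}"
  shows "reducible x \<or> block_form a x \<or> letter_form a B l C x"
  using assms
proof (induction rule: ZWords.induct)
  case empty
  have "[] \<approx> block_word a (Fin 0)" by (simp add: sword_rel.refl)
  then have "block_form a []" unfolding block_form_def by (intro exI[of _ "Fin 0"]) simp
  then show ?case by blast
next
  case (letter d)
  show ?case
  proof (cases "d = a")
    case True
    have "[Letter d] \<approx> block_word a (Fin 1)" using True by (simp add: sword_rel.refl)
    then have "block_form a [Letter d]"
      unfolding block_form_def using True by (intro exI[of _ "Fin 1"]) simp
    then show ?thesis by blast
  next
    case False
    have "letter_form a B l C [Letter d]"
      unfolding letter_form_def letter_rep_def using False letter
      by (intro exI[of _ "Fin 0"] exI[of _ d] exI[of _ "[]"] exI[of _ "Fin 0"])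
        (simp add: sword_rel.refl bounded_plain)
    then show ?thesis by blast
  qed
next
  case (power x q)
  then show ?case
    using forms_power_block[of x q] forms_power_letter[of x q] reducible_power[of x q] by auto
next
  case (concat x1 x2)
  then show ?case using forms_concat[of x1 x2] reducible_append[of x1 x2] reducible_append[of x2 x1]
    by auto
qed

end

lemma letter_elimination:
  assumes x: "x \<in> ZWords" "letters x \<subseteq> {..<B}" "\<not> reducible x"
  obtains z R where "x \<approx> subst (expand a B) z @ block_word a R" "z \<in> ZWords" "\<not> reducible z"
    "letters z \<subseteq> new_letters a B" "\<And>k. bounded l C k x \<Longrightarrow> bounded l (C - {a}) k z"
proof -
  have ex: "\<exists>z R. x \<approx> subst (expand a B) z @ block_word a R \<and> z \<in> ZWords \<and>
      letters z \<subseteq> new_letters a B \<and> (\<forall>k. bounded l C k x \<longrightarrow> bounded l (C - {a}) k z)"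
  proof (cases "block_form a x")
    case True
    then obtain R where "x \<approx> block_word a R" unfolding block_form_def by blast
    then show ?thesis by (intro exI[of _ "[]"] exI[of _ R]) (simp add: bounded_plain)
  next
    case False
    then obtain L d y R where rep: "letter_rep a B l C x L d y R"
      using letter_elimination_forms[OF x(1,2)] x(3) unfolding letter_form_def by blast
    show ?thesis
      using letter_repD[OF rep]
      by (intro exI[of _ "Letter (block_code B L d) # y"] exI[of _ R]) (auto simp: new_letters_def)
  qed
  then obtain z R where z: "x \<approx> subst (expand a B) z @ block_word a R" "z \<in> ZWords"
      "letters z \<subseteq> new_letters a B" "\<And>k. bounded l C k x \<Longrightarrow> bounded l (C - {a}) k z"
    by blast
  have "\<not> reducible z"
  proof
    assume "reducible z"
    then have "reducible (subst (expand a B) z @ block_word a R)"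
      by (intro reducible_append(1) reducible_subst expand_ne_ZWords) simp_all
    then show False using reducible_sword_eq[OF z(1)] x(3) by blast
  qed
  then show thesis using that z by blast
qed

section \<open>Separation by finite automata\<close>

text \<open>Realizing \<open>\<omega>\<close> by \<open>N\<close> computes a term in a given finite semigroup only if \<open>N\<close> is large and
  sufficiently divisible; hence the restriction on \<open>N\<close>.\<close>

definition separable :: "'a zword \<Rightarrow> 'a zword \<Rightarrow> bool" where
  "separable x y \<longleftrightarrow> (\<exists>(\<delta> :: nat \<Rightarrow> 'a \<Rightarrow> nat) Q s M N0.
    finite Q \<and> s \<in> Q \<and> (\<forall>p\<in>Q. \<forall>b. \<delta> p b \<in> Q) \<and> M > 0 \<and>
    (\<forall>N\<ge>N0. M dvd N \<longrightarrow> foldl \<delta> s (realize N x) \<noteq> foldl \<delta> s (realize N y)))"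

lemma separable_plain:
  fixes u v :: "'a list"
  assumes "u \<noteq> v"
  shows "separable (map Letter u) (map Letter v)"
proof -
  \<comment> \<open>State \<open>i\<close> records that the first \<open>i\<close> letters of
    \<open>u\<close> have been read. \<open>Suc (length u)\<close> is a dead state, so
    \<open>length u\<close> is reached from 0 by \<open>u\<close> alone.\<close>
  define \<delta> :: "nat \<Rightarrow> 'a \<Rightarrow> nat" where
    "\<delta> i b = (if i < length u \<and> u ! i = b then Suc i else Suc (length u))" for i b
  have realize: "realize N (map Letter w) = w" for N and w :: "'a list"
    by (induction w) auto
  have sink: "foldl \<delta> (Suc (length u)) w = Suc (length u)" for w
    by (induction w) (auto simp: \<delta>_def)
  have run: "foldl \<delta> i w = length u \<longleftrightarrow> w = drop i u" if "i \<le> length u" for i w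
    using that
  proof (induction w arbitrary: i)
    case (Cons b w)
    show ?case
    proof (cases "i < length u \<and> u ! i = b")
      case True
      then have "drop i u = b # drop (Suc i) u" "\<delta> i b = Suc i"
        using Cons_nth_drop_Suc[of i u] by (auto simp: \<delta>_def)
      then show ?thesis using True Cons.IH[of "Suc i"] by simp
    next
      case False
      then have "drop i u \<noteq> b # w"
        using Cons.prems Cons_nth_drop_Suc[of i u] by (cases "i = length u") auto
      moreover have "\<delta> i b = Suc (length u)" using False by (auto simp: \<delta>_def)
      ultimately show ?thesis using sink by auto
    qed
  qed auto
  show ?thesis
    unfolding separable_def
  proof (intro exI conjI allI impI)
    show "finite {..Suc (length u)}" by simp
    show "foldl \<delta> 0 (realize N (map Letter u)) \<noteq> foldl \<delta> 0 (realize N (map Letter v))" for N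
      using run[of 0 u] run[of 0 v] assms by (auto simp: realize)
    show "1 > (0 :: nat)" by simp
  qed (auto simp: \<delta>_def)
qed

section \<open>Counting the length of a block by a finite automaton\<close>

primrec block_length :: "nat \<Rightarrow> block \<Rightarrow> nat" where
  "block_length N (Fin k) = k"
| "block_length N (Om q) = nat (int N + q)"

lemma realize_block_word [simp]: "realize N (block_word a M) = replicate (block_length N M) a"
proof (cases M)
  case (Fin k)
  have "realize N (replicate k (Letter a)) = replicate k a" by (induction k) auto
  then show ?thesis using Fin by simp
next
  case (Om q)
  have "concat (replicate n [a]) = replicate n a" for n by (induction n) auto
  then show ?thesis using Om by simp
qed

text \<open>The automaton reads a block of length \<open>n\<close> by counting exactly below the threshold
  \<open>(2 c + 1) c\<close>, and modulo \<open>2 c + 1\<close> above it. This determines all finite exponents below the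
  threshold and all exponents \<open>\<omega> + q\<close> with \<open>\<bar>q\<bar> \<le> c\<close>.\<close>

definition count_step :: "nat \<Rightarrow> nat \<Rightarrow> nat" where
  "count_step c i =
    (if Suc i < (2 * c + 1) * c + (2 * c + 1) then Suc i else (2 * c + 1) * c)"

definition count_block :: "nat \<Rightarrow> nat \<Rightarrow> block" where
  "count_block c i =
    (if i < (2 * c + 1) * c then Fin i else Om (int ((i + c) mod (2 * c + 1)) - int c))"

lemma count_step_funpow:
  "(count_step c ^^ n) 0 = (if n < (2 * c + 1) * c then n
    else (2 * c + 1) * c + (n - (2 * c + 1) * c) mod (2 * c + 1))"
proof (induction n)
  case 0
  then show ?case by simp
next
  case (Suc n)
  define m T where "m = 2 * c + 1" and "T = (2 * c + 1) * c"
  have m: "m > 0" by (simp add: m_def)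
  have step: "count_step c i = (if Suc i < T + m then Suc i else T)" for i
    by (simp add: count_step_def m_def T_def)
  have IH: "(count_step c ^^ n) 0 = (if n < T then n else T + (n - T) mod m)"
    using Suc by (simp add: m_def T_def)
  have "count_step c ((count_step c ^^ n) 0) = (if Suc n < T then Suc n else T + (Suc n - T) mod m)"
  proof (cases "n < T")
    case True
    then show ?thesis using IH m by (auto simp: step)
  next
    case False
    then have *: "Suc n - T = Suc (n - T)" by simp
    show ?thesis
      unfolding * mod_Suc using False IH mod_less_divisor[OF m, of "n - T"] by (auto simp: step)
  qed
  then show ?case by (simp add: m_def T_def)
qed

text \<open>The modulus \<open>2 * c + 1\<close> divides \<open>N\<close>, so the length
  \<open>N + q\<close> has the residue of \<open>q\<close>. Adding \<open>c\<close> moves the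
  possible values of \<open>q\<close> into the range from 0 to \<open>2 * c\<close>, where the
  residue determines them. The lower bound on \<open>N\<close> keeps \<open>N + q\<close> above the
  threshold, hence apart from the finite blocks, which stay below it.\<close>

lemma count_block_length:
  assumes "case M of Fin k \<Rightarrow> k < c | Om q \<Rightarrow> \<bar>q\<bar> < int c"
    and N: "2 * c + 1 dvd N" "N \<ge> (2 * c + 1) * c + c"
  shows "count_block c ((count_step c ^^ block_length N M) 0) = M"
proof (cases M)
  case (Fin k)
  have "c \<le> (2 * c + 1) * c" by simp
  then have "k < (2 * c + 1) * c" using assms(1) Fin by simp
  then show ?thesis by (simp only: Fin block_length.simps count_step_funpow count_block_def if_True)
next
  case (Om q)
  define m T n where "m = 2 * c + 1" and "T = (2 * c + 1) * c" and "n = nat (int N + q)"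
  have q: "\<bar>q\<bar> < int c" using assms(1) Om by simp
  have N': "N \<ge> T + c" "m dvd N" using N by (auto simp: m_def T_def)
  have n: "n \<ge> T" "int n = int N + q" using N' q by (auto simp: n_def)
  have T: "T = m * c" by (simp add: m_def T_def)
  have eq: "(count_step c ^^ n) 0 = T + (n - T) mod m"
    using n by (simp add: count_step_funpow m_def T_def)
  have "(T + (n - T) mod m + c) mod m = (n + c) mod m"
  proof -
    have "(T + (n - T) mod m + c) mod m = (T + (n - T) + c) mod m"
      by (metis mod_add_cong mod_mod_trivial)
    then show ?thesis using n by simp
  qed
  moreover have "int ((n + c) mod m) = q + int c"
  proof -
    obtain j where j: "N = m * j" using N' by blast
    have "int ((n + c) mod m) = (int N + (q + int c)) mod int m"
      using n by (simp add: zmod_int algebra_simps)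
    also have "\<dots> = (q + int c) mod int m" unfolding j by simp
    also have "\<dots> = q + int c" using q by (intro mod_pos_pos_trivial) (auto simp: m_def)
    finally show ?thesis .
  qed
  moreover have "count_block c i = (if i < T then Fin i else Om (int ((i + c) mod m) - int c))" for i
    by (simp add: count_block_def m_def T_def)
  ultimately have "count_block c ((count_step c ^^ n) 0) = Om q"
    unfolding eq by simp
  then show ?thesis by (simp add: Om n_def)
qed

text \<open>A state is a pair of a state \<open>p\<close> for the new words and a counter for the
  current block of \<open>a\<close>. A letter \<open>d \<noteq> a\<close> closes the block: the new
  letter coded by the counter and \<open>d\<close> is passed to \<open>\<delta>'\<close>, and the
  counter returns to 0. The final counter still determines the last block.\<close>

lemma separable_letter_elimination:
  assumes x: "x \<approx> subst (expand a B) x' @ block_word a R" "letters x' \<subseteq> new_letters a B"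
    and y: "y \<approx> subst (expand a B) y' @ block_word a R'" "letters y' \<subseteq> new_letters a B"
    and sep: "separable x' y' \<or> R \<noteq> R'"
  shows "separable x y"
proof -
  \<comment> \<open>If \<open>R\<close> and \<open>R'\<close> differ, a one-state automaton takes
    the place of one separating \<open>x'\<close> and \<open>y'\<close>. The weakened inequality
    lets both cases share one construction.\<close>
  have "\<exists>(\<delta>' :: nat \<Rightarrow> nat \<Rightarrow> nat) Q' s' M' N0'.
      finite Q' \<and> s' \<in> Q' \<and> (\<forall>p\<in>Q'. \<forall>b. \<delta>' p b \<in> Q') \<and> M' > 0 \<and>
      (\<forall>N\<ge>N0'. M' dvd N \<longrightarrow>
        foldl \<delta>' s' (realize N x') \<noteq> foldl \<delta>' s' (realize N y') \<or> R \<noteq> R')"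
  proof (cases "R = R'")
    case True
    then show ?thesis using sep unfolding separable_def by simp
  next
    case False
    then show ?thesis by (intro exI[of _ "\<lambda>_ _. 0"] exI[of _ "{0}"] exI[of _ 0] exI[of _ 1]) simp
  qed
  then obtain \<delta>' :: "nat \<Rightarrow> nat \<Rightarrow> nat" and Q' s' M' N0' where
    Q': "finite Q'" "s' \<in> Q'" "\<And>p b. p \<in> Q' \<Longrightarrow> \<delta>' p b \<in> Q'" "M' > 0" and
    sep': "\<And>N. N \<ge> N0' \<Longrightarrow> M' dvd N \<Longrightarrow>
        foldl \<delta>' s' (realize N x') \<noteq> foldl \<delta>' s' (realize N y') \<or> R \<noteq> R'"
    by metis
  \<comment> \<open>These are all blocks the automaton has to recognize; \<open>c\<close> is chosen
    beyond all their exponents.\<close>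
  define Bs where "Bs = {R, R'} \<union> (\<lambda>b. fst (block_decode B b)) ` (letters x' \<union> letters y')"
  have "finite ((\<lambda>M. case M of Fin k \<Rightarrow> k | Om q \<Rightarrow> nat \<bar>q\<bar>) ` Bs)" by (simp add: Bs_def)
  then obtain c where c: "\<forall>i \<in> (\<lambda>M. case M of Fin k \<Rightarrow> k | Om q \<Rightarrow> nat \<bar>q\<bar>) ` Bs. i < c"
    unfolding finite_nat_set_iff_bounded by blast
  have Bs: "case M of Fin k \<Rightarrow> k < c | Om q \<Rightarrow> \<bar>q\<bar> < int c" if "M \<in> Bs" for M
    using c that by (cases M) force+
  define m T where "m = 2 * c + 1" and "T = (2 * c + 1) * c"
  define \<delta> where "\<delta> s b = (case prod_decode s of (p, i) \<Rightarrow>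
    prod_encode (if b = a then (p, count_step c i)
      else (\<delta>' p (block_code B (count_block c i) b), 0)))" for s b
  define Q where "Q = prod_encode ` (Q' \<times> {..<T + m})"
  have \<delta>: "\<delta> (prod_encode (p, i)) b = prod_encode (if b = a then (p, count_step c i)
      else (\<delta>' p (block_code B (count_block c i) b), 0))" for p i b
    by (simp add: \<delta>_def)
  have block: "foldl \<delta> (prod_encode (p, i)) (replicate n a) = prod_encode (p, (count_step c ^^ n) i)"
    for p i n
  proof (induction n arbitrary: i)
    case (Suc n)
    then show ?case by (simp add: \<delta> funpow_swap1)
  qed simp
  have run: "foldl \<delta> (prod_encode (p, 0)) (concat (map (\<lambda>b. realize N (expand a B b)) w)) =
      prod_encode (foldl \<delta>' p w, 0)"
    if N: "m dvd N" "N \<ge> T + c" and w: "set w \<subseteq> letters x' \<union> letters y'" for p w N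
    using w
  proof (induction w arbitrary: p)
    case (Cons b w)
    then obtain M d where b: "b = block_code B M d" "d \<noteq> a" "d < B"
      using x(2) y(2) unfolding new_letters_def by auto
    then have "M \<in> Bs" using Cons.prems by (force simp: Bs_def)
    then have "count_block c ((count_step c ^^ block_length N M) 0) = M"
      using N Bs by (intro count_block_length) (auto simp: m_def T_def)
    then show ?case using Cons b by (simp add: block \<delta>)
  qed simp
  have final: "foldl \<delta> (prod_encode (s', 0)) (realize N (subst (expand a B) w @ block_word a M)) =
      prod_encode (foldl \<delta>' s' (realize N w), (count_step c ^^ block_length N M) 0)"
    if "m dvd N" "N \<ge> T + c" "letters w \<subseteq> letters x' \<union> letters y'" for w N M
    using run[of N "realize N w" s'] that set_realize[of N w]
    by (simp add: realize_subst block)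
  obtain N1 where N1: "\<And>N. N \<ge> N1 \<Longrightarrow>
      realize N x = realize N (subst (expand a B) x' @ block_word a R)"
    using sword_eq_realize[OF x(1)] by blast
  obtain N2 where N2: "\<And>N. N \<ge> N2 \<Longrightarrow>
      realize N y = realize N (subst (expand a B) y' @ block_word a R')"
    using sword_eq_realize[OF y(1)] by blast
  show ?thesis
    unfolding separable_def
  proof (intro exI conjI allI impI ballI)
    show "finite Q" using Q'(1) by (simp add: Q_def)
    show "prod_encode (s', 0) \<in> Q" using Q'(2) by (auto simp: Q_def m_def)
    show "\<delta> p b \<in> Q" if pQ: "p \<in> Q" for p b
    proof -
      obtain p' i where p: "p = prod_encode (p', i)" "p' \<in> Q'" "i < T + m"
        using pQ by (auto simp: Q_def)
      have "count_step c i < T + m" by (simp add: count_step_def T_def m_def)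
      then show ?thesis using p Q'(3) by (auto simp: \<delta> Q_def m_def)
    qed
    show "m * M' > 0" using Q'(4) by (simp add: m_def)
    fix N
    assume N: "N0' + N1 + N2 + T + c \<le> N" "m * M' dvd N"
    then have N': "m dvd N" "M' dvd N"
      by (auto dest: dvd_mult_left dvd_mult_right)
    show "foldl \<delta> (prod_encode (s', 0)) (realize N x) \<noteq> foldl \<delta> (prod_encode (s', 0)) (realize N y)"
    proof
      assume "foldl \<delta> (prod_encode (s', 0)) (realize N x) =
        foldl \<delta> (prod_encode (s', 0)) (realize N y)"
      then have eq: "foldl \<delta>' s' (realize N x') = foldl \<delta>' s' (realize N y')"
          "(count_step c ^^ block_length N R) 0 = (count_step c ^^ block_length N R') 0"
        using N N' N1[of N] N2[of N] by (simp_all add: final del: realize_simps)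
      have "count_block c ((count_step c ^^ block_length N M) 0) = M" if "M \<in> {R, R'}" for M
        using N N' Bs that by (intro count_block_length) (auto simp: m_def T_def Bs_def)
      then have "R = R'" using eq(2) by (metis insertI1 insertI2)
      then show False using eq(1) sep'[of N] N N' by auto
    qed
  qed
qed

section \<open>Descent along the measure\<close>

lemma bounded_0_plain: "w \<in> ZWords \<Longrightarrow> bounded 0 C 0 w \<Longrightarrow> plain w"
  by (subst (asm) ZWords_iff) (auto simp: plain_def small_base_def)

lemma plain_Letter: "plain w \<Longrightarrow> \<exists>u. w = map Letter u"
proof (induction w)
  case (Cons f w)
  then show ?case by (cases f) (auto intro: exI[of _ "_ # _"])
qed simp

text \<open>A non-empty plain base has a letter, so with no letters allowed at length
  \<open>Suc l\<close> its length is at most \<open>l\<close>. At length \<open>l\<close> the set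
  \<open>D\<close> imposes nothing new.\<close>

lemma bounded_letters:
  "w \<in> ZWords \<Longrightarrow> letters w \<subseteq> D \<Longrightarrow> bounded (Suc l) {} k w \<Longrightarrow> bounded l D k w"
proof (induction w arbitrary: k rule: word_induct)
  case (OmegaPow x q w)
  have split: "bounded l C k (OmegaPow x q # w) \<longleftrightarrow> bounded l C k [OmegaPow x q] \<and> bounded l C k w"
    for l and C :: "'a set"
    using bounded_append[of l C k "[OmegaPow x q]" w] by simp
  have x: "x \<in> ZWords" "x \<noteq> []" "letters x \<subseteq> D"
    using OmegaPow.prems by (auto simp: ne_ZWords_def)
  have "small_base l D x" if "small_base (Suc l) {} x"
    using that x by (cases x; cases "hd x") (auto simp: small_base_def plain_def)
  then have "bounded l D k [OmegaPow x q]"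
    using OmegaPow.IH(1) OmegaPow.prems x unfolding split by (cases k) auto
  then show ?case using OmegaPow unfolding split by simp
qed (auto simp: bounded_plain)

text \<open>For \<open>l = 0\<close> no base is small, so \<open>Suc k\<close> just bounds the
  nesting depth. The innermost bases at full depth are plain and become small for every
  \<open>l\<close> beyond their length, which saves one level.\<close>

lemma bounded_pred:
  "w \<in> ZWords \<Longrightarrow> bounded 0 {} (Suc k) w \<Longrightarrow> \<exists>l0. \<forall>l\<ge>l0. bounded l {} k w"
proof (induction w arbitrary: k rule: word_induct)
  case (OmegaPow x q w)
  have split: "bounded l C k (OmegaPow x q # w) \<longleftrightarrow> bounded l C k [OmegaPow x q] \<and> bounded l C k w"
    for l k and C :: "'a set"
    using bounded_append[of l C k "[OmegaPow x q]" w] by simp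
  have x: "x \<in> ZWords" "x \<noteq> []" using OmegaPow.prems by (auto simp: ne_ZWords_def)
  then have bx: "bounded 0 {} k x"
    using OmegaPow.prems(2) unfolding split by (auto simp: small_base_def)
  obtain l1 where l1: "\<forall>l\<ge>l1. bounded l {} k w" using OmegaPow unfolding split by fastforce
  have "\<exists>l2. \<forall>l\<ge>l2. bounded l {} k [OmegaPow x q]"
  proof (cases k)
    case 0
    then show ?thesis
      using bounded_0_plain[OF x(1)] bx
      by (intro exI[of _ "Suc (length x)"]) (auto simp: small_base_def)
  next
    case (Suc k')
    then show ?thesis using OmegaPow.IH(1)[of k'] x bx by auto
  qed
  then obtain l2 where "\<forall>l\<ge>l2. bounded l {} k [OmegaPow x q]" ..
  then show ?case using l1 unfolding split by (intro exI[of _ "max l1 l2"]) auto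
qed (auto simp: bounded_plain)

text \<open>With \<open>l = 0\<close> and no letters allowed, any bound on the nesting depth of
  powers will do as \<open>k0\<close>.\<close>

lemma bounded_exists: "\<exists>k0. \<forall>k\<ge>k0. bounded 0 {} k w"
proof (induction w rule: word_induct)
  case (OmegaPow x q w)
  then obtain k1 k2 where k: "\<forall>k\<ge>k1. bounded 0 {} k x" "\<forall>k\<ge>k2. bounded 0 {} k w" by blast
  have "bounded 0 {} k (OmegaPow x q # w)" if k12: "k \<ge> Suc (k1 + k2)" for k
  proof -
    obtain k' where "k = Suc k'" using k12 by (cases k) auto
    then have "bounded 0 {} k [OmegaPow x q]" using k k12 by simp
    then show ?thesis using bounded_append[of 0 "{}" k "[OmegaPow x q]" w] k k12 by simp
  qed
  then show ?case by blast
qed (auto simp: bounded_plain)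

lemma separable_bounded:
  fixes x y :: "nat zword"
  assumes "x \<in> ZWords" "y \<in> ZWords" "\<not> reducible x" "\<not> reducible y" "\<not> x \<approx> y"
    "bounded l C k x" "bounded l C k y" "finite C"
  shows "separable x y"
  using assms
proof (induction "(k, l, card C)" arbitrary: k l C x y
    rule: wf_induct_rule[OF wf_lex_prod[OF wf_less_than wf_lex_prod[OF wf_less_than wf_less_than]]])
  case 1
  note IH = "1.hyps" and xy = "1.prems"
  \<comment> \<open>The descent in lexicographic order: remove a letter from \<open>C\<close>; with
    \<open>C\<close> empty, lower \<open>l\<close> and refill \<open>C\<close> by all letters of
    both words; with \<open>l = 0\<close> as well, lower \<open>k\<close> and choose
    \<open>l\<close> anew. At the bottom both words are plain.\<close>
  consider (C) a where "a \<in> C" | (l) l' where "C = {}" "l = Suc l'" | (k) k' where "C = {}" "l = 0" "k = Suc k'"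
    | (z) "C = {}" "l = 0" "k = 0"
    by (cases l; cases k) auto
  then show ?case
  proof cases
    case C
    have "finite (letters x \<union> letters y)" by simp
    then obtain B where B: "letters x \<union> letters y \<subseteq> {..<B}"
      unfolding finite_nat_set_iff_bounded by blast
    obtain x' R where x': "x \<approx> subst (expand a B) x' @ block_word a R" "x' \<in> ZWords"
        "\<not> reducible x'" "letters x' \<subseteq> new_letters a B"
        "\<And>k. bounded l C k x \<Longrightarrow> bounded l (C - {a}) k x'"
      using letter_elimination[of x B] B xy by blast
    obtain y' R' where y': "y \<approx> subst (expand a B) y' @ block_word a R'" "y' \<in> ZWords"
        "\<not> reducible y'" "letters y' \<subseteq> new_letters a B"
        "\<And>k. bounded l C k y \<Longrightarrow> bounded l (C - {a}) k y'"
      using letter_elimination[of y B] B xy by blast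
    have "separable x' y'" if "\<not> x' \<approx> y'"
      using that x' y' xy C card_Diff1_less[of C a] by (intro IH[of k l "C - {a}"]) auto
    \<comment> \<open>Expansion respects the sword relation, so equivalent new words with equal last
      blocks would make \<open>x\<close> and \<open>y\<close> equivalent.\<close>
    moreover have "R \<noteq> R'" if "x' \<approx> y'"
    proof
      assume "R = R'"
      then have "subst (expand a B) x' @ block_word a R \<approx> subst (expand a B) y' @ block_word a R'"
        using that by (intro sword_rel.concat subst_sword_eq expand_ne_ZWords)
          (auto intro: sword_rel.refl)
      then show False using x'(1) y'(1) xy(5) by (meson sword_rel.sym sword_rel.trans)
    qed
    ultimately show ?thesis
      by (intro separable_letter_elimination[OF x'(1,4) y'(1,4)]) blast
  next
    case l
    then show ?thesis
      using xy by (intro IH[of k l' "letters x \<union> letters y"]) (auto intro: bounded_letters)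
  next
    case k
    obtain l1 l2 where "\<forall>l\<ge>l1. bounded l {} k' x" "\<forall>l\<ge>l2. bounded l {} k' y"
      using bounded_pred[of x k'] bounded_pred[of y k'] xy k by auto
    then show ?thesis
      using xy k by (intro IH[of k' "max l1 l2" "{}"]) auto
  next
    case z
    then have "plain x" "plain y" using xy bounded_0_plain by blast+
    then obtain u v where "x = map Letter u" "y = map Letter v" using plain_Letter by blast
    moreover have "x \<noteq> y" using xy sword_rel.refl by blast
    ultimately show ?thesis using separable_plain[of u v] by auto
  qed
qed

text \<open>The letter codes need the alphabet \<open>nat\<close>, so the finitely many letters are
  renamed injectively. Renaming back is a substitution too, hence the renamed words stay irreducible
  and inequivalent.\<close>

lemma irreducible_separable:
  fixes x y :: "'a zword"
  assumes xy: "x \<in> ZWords" "y \<in> ZWords" "\<not> reducible x" "\<not> reducible y" "\<not> x \<approx> y"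
  shows "separable x y"
proof -
  have "finite (letters x \<union> letters y)" by simp
  then obtain g :: "'a \<Rightarrow> nat" where g: "inj_on g (letters x \<union> letters y)"
    using finite_imp_inj_to_nat_seg by metis
  define h where "h = inv_into (letters x \<union> letters y) g"
  define f where "f w = subst (\<lambda>b. [Letter (g b)]) w" for w
  define f' where "f' w = subst (\<lambda>n. [Letter (h n)]) w" for w
  have ne: "[Letter b] \<in> ne_ZWords" for b by (simp add: ne_ZWords_def)
  have "f' (f w) = w" if "letters w \<subseteq> letters x \<union> letters y" for w
    using that
  proof (induction w rule: word_induct)
    case (Letter b w)
    then show ?case by (simp add: f_def f'_def h_def inv_into_f_f[OF g])
  qed (simp_all add: f_def f'_def)
  then have inv: "f' (f x) = x" "f' (f y) = y" by simp_all
  have ZW: "f x \<in> ZWords" "f y \<in> ZWords" unfolding f_def by (intro subst_ZWords ne xy)+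
  have irred: "\<not> reducible (f x)" "\<not> reducible (f y)"
    using xy inv reducible_subst[of "\<lambda>n. [Letter (h n)]"] ne unfolding f'_def by metis+
  have neq: "\<not> f x \<approx> f y"
    using xy inv subst_sword_eq[of "\<lambda>n. [Letter (h n)]"] ne unfolding f'_def by metis
  obtain k1 k2 where "\<forall>k\<ge>k1. bounded 0 {} k (f x)" "\<forall>k\<ge>k2. bounded 0 {} k (f y)"
    using bounded_exists by meson
  then have "separable (f x) (f y)"
    by (intro separable_bounded[OF ZW irred neq, of 0 "{}" "max k1 k2"]) auto
  then obtain \<delta> :: "nat \<Rightarrow> nat \<Rightarrow> nat" and Q s M N0 where
    Q: "finite Q" "s \<in> Q" "\<forall>p\<in>Q. \<forall>b. \<delta> p b \<in> Q" "M > 0"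
    "\<forall>N\<ge>N0. M dvd N \<longrightarrow> foldl \<delta> s (realize N (f x)) \<noteq> foldl \<delta> s (realize N (f y))"
    unfolding separable_def by blast
  have "realize N (f w) = map g (realize N w)" for N w
    by (simp add: f_def realize_subst)
  then have "\<forall>N\<ge>N0. M dvd N \<longrightarrow> foldl (\<lambda>p b. \<delta> p (g b)) s (realize N x) \<noteq>
      foldl (\<lambda>p b. \<delta> p (g b)) s (realize N y)"
    using Q(5) by (simp add: foldl_map)
  then show ?thesis unfolding separable_def
    using Q by (intro exI[of _ "\<lambda>p b. \<delta> p (g b)"] exI[of _ Q] exI[of _ s] exI[of _ M] exI[of _ N0]) auto
qed

section \<open>Pseudo-inverses as Drazin inverses\<close>

locale carrier_semigroup =
  fixes S :: "'s set" and m :: "'s \<Rightarrow> 's \<Rightarrow> 's" (infixl "\<cdot>" 70)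
  assumes semigroup_on: "semigroup_on S m"
begin

lemma closed [simp]: "x \<in> S \<Longrightarrow> y \<in> S \<Longrightarrow> x \<cdot> y \<in> S"
  using semigroup_on unfolding semigroup_on_def by blast

lemma assoc: "x \<in> S \<Longrightarrow> y \<in> S \<Longrightarrow> z \<in> S \<Longrightarrow> (x \<cdot> y) \<cdot> z = x \<cdot> (y \<cdot> z)"
  using semigroup_on unfolding semigroup_on_def by blast

abbreviation spow :: "'s \<Rightarrow> nat \<Rightarrow> 's" where
  "spow \<equiv> sg_pow m"

lemma pow_1 [simp]: "spow x (Suc 0) = x"
  by (simp add: sg_pow_def)

lemma pow_Suc: "n > 0 \<Longrightarrow> spow x (Suc n) = x \<cdot> spow x n"
  by (cases n) (auto simp: sg_pow_def)

lemma pow_closed [simp]: "x \<in> S \<Longrightarrow> spow x n \<in> S"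
proof -
  assume "x \<in> S"
  then have "(m x ^^ k) x \<in> S" for k by (induction k) auto
  then show ?thesis by (simp add: sg_pow_def)
qed

lemma pow_add: "x \<in> S \<Longrightarrow> i > 0 \<Longrightarrow> j > 0 \<Longrightarrow> spow x (i + j) = spow x i \<cdot> spow x j"
proof (induction i)
  case (Suc i)
  then show ?case by (cases "i = 0") (simp_all add: pow_Suc assoc)
qed simp

lemma pow_intertwine:
  assumes S: "x \<in> S" "y \<in> S" "z \<in> S" and "x \<cdot> z = z \<cdot> y" and "n > 0"
  shows "spow x n \<cdot> z = z \<cdot> spow y n"
  using \<open>n > 0\<close>
proof (induction n)
  case (Suc n)
  show ?case
  proof (cases "n = 0")
    case False
    have "spow x (Suc n) \<cdot> z = x \<cdot> (z \<cdot> spow y n)"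
      using Suc False S by (simp add: pow_Suc assoc)
    also have "\<dots> = (z \<cdot> y) \<cdot> spow y n" using S assms(4) by (simp flip: assoc)
    finally show ?thesis using False S by (simp add: pow_Suc assoc)
  qed (use assms in simp)
qed simp

lemma pow_commute: "x \<in> S \<Longrightarrow> z \<in> S \<Longrightarrow> x \<cdot> z = z \<cdot> x \<Longrightarrow> n > 0 \<Longrightarrow> spow x n \<cdot> z = z \<cdot> spow x n"
  by (rule pow_intertwine)

lemma pow_Suc_right: "x \<in> S \<Longrightarrow> n > 0 \<Longrightarrow> spow x (Suc n) = spow x n \<cdot> x"
  using pow_commute[of x x n] by (simp add: pow_Suc)

lemma pow_mult: "x \<in> S \<Longrightarrow> i > 0 \<Longrightarrow> j > 0 \<Longrightarrow> spow (spow x i) j = spow x (i * j)"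
proof (induction j)
  case (Suc j)
  then show ?case by (cases "j = 0") (simp_all add: pow_Suc pow_add)
qed simp

lemma pow_mult_distrib:
  assumes S: "x \<in> S" "y \<in> S" and xy: "x \<cdot> y = y \<cdot> x" and "n > 0"
  shows "spow (x \<cdot> y) n = spow x n \<cdot> spow y n"
  using \<open>n > 0\<close>
proof (induction n)
  case (Suc n)
  show ?case
  proof (cases "n = 0")
    case False
    have "spow (x \<cdot> y) (Suc n) = x \<cdot> (y \<cdot> spow x n) \<cdot> spow y n"
      using Suc False S by (simp add: pow_Suc assoc)
    also have "\<dots> = x \<cdot> (spow x n \<cdot> y) \<cdot> spow y n" using pow_commute[of x y n] S xy False by simp
    finally show ?thesis using False S by (simp add: pow_Suc assoc)
  qed simp
qed simp

lemma pow_absorb: "x \<in> S \<Longrightarrow> e \<in> S \<Longrightarrow> x \<cdot> e = x \<Longrightarrow> n > 0 \<Longrightarrow> spow x n \<cdot> e = spow x n"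
proof (induction n)
  case (Suc n)
  then show ?case by (cases "n = 0") (simp_all add: pow_Suc assoc)
qed simp

lemma idem_pow: "e \<in> S \<Longrightarrow> e \<cdot> e = e \<Longrightarrow> n > 0 \<Longrightarrow> spow e n = e"
proof (induction n)
  case (Suc n)
  then show ?case by (cases "n = 0") (simp_all add: pow_Suc)
qed simp

text \<open>The equations of a Drazin inverse, to be verified instead of the definite descriptions
  inside \<open>pseudo_inv\<close>.\<close>

definition drazin :: "'s \<Rightarrow> 's \<Rightarrow> bool" where
  "drazin x y \<longleftrightarrow> x \<in> S \<and> y \<in> S \<and> x \<cdot> y = y \<cdot> x \<and> y \<cdot> (x \<cdot> y) = y \<and>
    (\<exists>n>0. spow x n \<cdot> (x \<cdot> y) = spow x n)"

lemma group_mk_groupD: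
  assumes "group (mk_group H m e)"
  shows "e \<in> H" "\<And>x. x \<in> H \<Longrightarrow> e \<cdot> x = x" "\<And>x. x \<in> H \<Longrightarrow> x \<cdot> e = x"
    "\<And>x. x \<in> H \<Longrightarrow> \<exists>y\<in>H. x \<cdot> y = e \<and> y \<cdot> x = e"
proof -
  interpret group "mk_group H m e" by (rule assms)
  show "e \<in> H" using one_closed by simp
  show "e \<cdot> x = x" if "x \<in> H" for x using l_one[of x] that by simp
  show "x \<cdot> e = x" if "x \<in> H" for x using r_one[of x] that by simp
  show "\<exists>y\<in>H. x \<cdot> y = e \<and> y \<cdot> x = e" if "x \<in> H" for x
    using r_inv[of x] l_inv[of x] inv_closed[of x] that by auto
qed

lemma group_idem_eq_one:
  assumes "group (mk_group H m e)" "H \<subseteq> S" "f \<in> H" "f \<cdot> f = f"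
  shows "f = e"
proof -
  obtain g where g: "g \<in> H" "f \<cdot> g = e" using group_mk_groupD(4)[OF assms(1,3)] by blast
  have "f = f \<cdot> (f \<cdot> g)" using group_mk_groupD(3)[OF assms(1,3)] g by simp
  also have "\<dots> = (f \<cdot> f) \<cdot> g" using assms g by (intro assoc[symmetric]) auto
  finally show ?thesis using assms g by simp
qed

lemma group_one_unique:
  assumes G: "group (mk_group G m e)" "G \<subseteq> S" and H: "group (mk_group H m f)" "H \<subseteq> S"
    and x: "x \<in> G" "x \<in> H"
  shows "e = f"
proof -
  obtain g where g: "g \<in> G" "x \<cdot> g = e" using group_mk_groupD(4)[OF G(1) x(1)] by blast
  obtain h where h: "h \<in> H" "h \<cdot> x = f" using group_mk_groupD(4)[OF H(1) x(2)] by blast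
  have S: "e \<in> S" "f \<in> S" "x \<in> S" "g \<in> S" "h \<in> S"
    using group_mk_groupD(1)[OF G(1)] group_mk_groupD(1)[OF H(1)] G H x g h by auto
  have "f \<cdot> e = e" using g S group_mk_groupD(2)[OF H(1) x(2)] by (metis assoc)
  moreover have "f \<cdot> e = f" using h S group_mk_groupD(3)[OF G(1) x(1)] by (metis assoc)
  ultimately show ?thesis by simp
qed

text \<open>The product \<open>e = x y\<close> is idempotent. The largest subgroup with identity
  \<open>e\<close> contains the powers of \<open>x\<close> from \<open>n\<close> on, with inverses
  the powers of \<open>y\<close>, and in it \<open>y\<close> is inverse to
  \<open>x e\<close>.\<close>

lemma drazin_pseudo_inv:
  assumes "drazin x y"
  shows "pseudo_inv S m x = y"
proof -
  obtain n where S: "x \<in> S" "y \<in> S" and xy: "x \<cdot> y = y \<cdot> x" and y: "y \<cdot> (x \<cdot> y) = y" and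
    n: "n > 0" "spow x n \<cdot> (x \<cdot> y) = spow x n"
    using assms unfolding drazin_def by blast
  define e where "e = x \<cdot> y"
  have eS: "e \<in> S" using S by (simp add: e_def)
  have ey: "y \<cdot> e = y" "e \<cdot> y = y" using y xy S by (simp_all add: e_def assoc)
  have ee: "e \<cdot> e = e" using ey(1) S eS assoc[of x y e] by (simp add: e_def)
  have ex: "e \<cdot> x = x \<cdot> e" using S xy assoc[of x y x] by (simp add: e_def)
  \<comment> \<open>The group of units of the local monoid e S e, hence the largest subgroup with
    identity \<open>e\<close>.\<close>
  define G where "G = {g \<in> S. e \<cdot> g = g \<and> g \<cdot> e = g \<and>
    (\<exists>h\<in>S. e \<cdot> h = h \<and> h \<cdot> e = h \<and> g \<cdot> h = e \<and> h \<cdot> g = e)}"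
  have GS: "G \<subseteq> S" by (auto simp: G_def)
  have G: "group (mk_group G m e)"
  proof (rule groupI)
    fix a b
    assume "a \<in> carrier (mk_group G m e)" "b \<in> carrier (mk_group G m e)"
    then obtain a' b' where
      a: "a \<in> S" "e \<cdot> a = a" "a \<cdot> e = a" "a' \<in> S" "e \<cdot> a' = a'" "a' \<cdot> e = a'" "a \<cdot> a' = e" "a' \<cdot> a = e" and
      b: "b \<in> S" "e \<cdot> b = b" "b \<cdot> e = b" "b' \<in> S" "e \<cdot> b' = b'" "b' \<cdot> e = b'" "b \<cdot> b' = e" "b' \<cdot> b = e"
      by (auto simp: G_def)
    have "e \<cdot> (a \<cdot> b) = a \<cdot> b" "a \<cdot> b \<cdot> e = a \<cdot> b" "e \<cdot> (b' \<cdot> a') = b' \<cdot> a'" "b' \<cdot> a' \<cdot> e = b' \<cdot> a'"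
      using a b eS by (metis assoc)+
    moreover have "a \<cdot> b \<cdot> (b' \<cdot> a') = e"
      using a b by (metis assoc closed)
    moreover have "b' \<cdot> a' \<cdot> (a \<cdot> b) = e"
      using a b by (metis assoc closed)
    ultimately have "a \<cdot> b \<in> G"
      unfolding G_def using a(1,4) b(1,4)
      by (intro CollectI conjI bexI[of _ "b' \<cdot> a'"]) (assumption | simp)+
    then show "a \<otimes>\<^bsub>mk_group G m e\<^esub> b \<in> carrier (mk_group G m e)" by simp
  next
    show "\<one>\<^bsub>mk_group G m e\<^esub> \<in> carrier (mk_group G m e)" using eS ee by (auto simp: G_def)
  next
    fix a
    assume "a \<in> carrier (mk_group G m e)"
    then show "\<exists>b\<in>carrier (mk_group G m e). b \<otimes>\<^bsub>mk_group G m e\<^esub> a = \<one>\<^bsub>mk_group G m e\<^esub>"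
      by (auto simp: G_def)
  qed (use GS in \<open>auto simp: G_def assoc\<close>)
  have sub: "H \<subseteq> G" if H: "group (mk_group H m e)" "H \<subseteq> S" for H
  proof
    fix g
    assume g: "g \<in> H"
    obtain h where h: "h \<in> H" "g \<cdot> h = e" "h \<cdot> g = e" using group_mk_groupD(4)[OF H(1) g] by blast
    show "g \<in> G"
      unfolding G_def using g h H group_mk_groupD(2,3)[OF H(1)] by blast
  qed
  have max: "sg_max_subgroup S m G"
    unfolding sg_max_subgroup_def sg_subgroup_def
  proof (intro conjI allI impI)
    show "\<exists>e. group (mk_group G m e)" using G by blast
    fix H
    assume "H \<subseteq> S \<and> (\<exists>e. group (mk_group H m e))" "G \<subseteq> H"
    then obtain f where f: "group (mk_group H m f)" "H \<subseteq> S" by blast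
    have "e \<in> H" using group_mk_groupD(1)[OF G] \<open>G \<subseteq> H\<close> by blast
    then have "e = f" using group_idem_eq_one f ee by blast
    then show "H = G" using f sub \<open>G \<subseteq> H\<close> by blast
  qed (rule GS)
  have pow_G: "spow x k \<in> G" if "k \<ge> n" for k
  proof -
    have k: "k > 0" using that n by simp
    have "spow x k \<cdot> e = spow x k"
    proof (cases "k = n")
      case False
      then have "spow x k = spow x (k - n) \<cdot> spow x n"
        using pow_add[of x "k - n" n] that n S by simp
      then show ?thesis using n S eS by (simp add: assoc e_def)
    qed (use n in \<open>simp add: e_def\<close>)
    moreover have "e \<cdot> spow x k = spow x k \<cdot> e" using pow_commute[of x e k] S eS ex k by simp
    moreover have "spow y k \<cdot> e = spow y k" using pow_absorb[of y e k] S eS ey k by simp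
    moreover from this have "e \<cdot> spow y k = spow y k"
      using pow_commute[of y e k] S eS ey k by simp
    moreover have "spow x k \<cdot> spow y k = e" "spow y k \<cdot> spow x k = e"
      using pow_mult_distrib[OF S xy k] pow_mult_distrib[OF S(2,1) xy[symmetric] k] idem_pow[OF eS ee k]
      unfolding xy[symmetric] e_def[symmetric] by simp_all
    ultimately show ?thesis
      unfolding G_def using S
      by (intro CollectI conjI bexI[of _ "spow y k"]) (assumption | simp)+
  qed
  have fin: "finite {k. k \<ge> 1 \<and> spow x k \<notin> G}"
  proof (rule finite_subset)
    show "{k. k \<ge> 1 \<and> spow x k \<notin> G} \<subseteq> {..<n}" using pow_G not_less by blast
  qed simp
  have epi_group: "epi_group S m x = G"
    unfolding epi_group_def
  proof (rule the_equality)
    show "sg_max_subgroup S m G \<and> finite {n. n \<ge> 1 \<and> spow x n \<notin> G}" using max fin by simp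
    fix H
    assume H: "sg_max_subgroup S m H \<and> finite {n. n \<ge> 1 \<and> spow x n \<notin> H}"
    then obtain f where f: "group (mk_group H m f)" "H \<subseteq> S"
      unfolding sg_max_subgroup_def sg_subgroup_def by blast
    \<comment> \<open>Some power beyond \<open>n\<close> lies in both subgroups; sharing an element,
      they have the same identity.\<close>
    have "finite ({k. k \<ge> 1 \<and> spow x k \<notin> H} \<union> {..n})" using H by simp
    then obtain k where "k \<notin> {k. k \<ge> 1 \<and> spow x k \<notin> H} \<union> {..n}"
      using ex_new_if_finite[OF infinite_UNIV_nat] by blast
    then have "spow x k \<in> H" "spow x k \<in> G" using pow_G[of k] by auto
    then have "e = f" using group_one_unique[OF G GS f] by blast
    then have "H \<subseteq> G" using f sub by blast
    then show "H = G" using H max unfolding sg_max_subgroup_def by blast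
  qed
  have epi_idem: "epi_idem S m x = e"
    unfolding epi_idem_def epi_group
  proof (rule the_equality)
    fix f
    assume "group (mk_group G m f)"
    then show "f = e" using group_idem_eq_one[OF _ GS _ ee, of f] group_mk_groupD(1)[OF G] by simp
  qed (rule G)
  have xee: "x \<cdot> e \<cdot> e = x \<cdot> e" using S eS ee by (simp add: assoc)
  have exe: "e \<cdot> (x \<cdot> e) = x \<cdot> e" using assoc[of e x e] S eS ex xee by simp
  have xey: "x \<cdot> e \<cdot> y = e" using assoc[of x e y] S eS ey by (simp add: e_def)
  have "y \<cdot> (x \<cdot> e) = (x \<cdot> y) \<cdot> e" using assoc[of y x e] S eS xy by simp
  then have yxe: "y \<cdot> (x \<cdot> e) = e" using ee by (simp flip: e_def)
  have "x \<cdot> e \<in> G" "y \<in> G"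
    unfolding G_def using S eS ey xee exe xey yxe by (blast intro: closed)+
  then show ?thesis
    unfolding pseudo_inv_def epi_idem epi_group Let_def
    using group.inv_equality[OF G, of y "x \<cdot> e"] yxe by simp
qed

end

section \<open>Existence of Drazin inverses, Cline's formula and omega-powers\<close>

context carrier_semigroup
begin

text \<open>Some power \<open>p\<close> of \<open>x\<close> has a group inverse \<open>g\<close>. As
  \<open>x\<close> commutes with \<open>g\<close> and \<open>e\<close>, a suitable power of
  \<open>x\<close> times powers of \<open>g\<close> inverts \<open>x\<close> relative to
  \<open>e\<close>.\<close>

lemma epigroup_drazin:
  assumes "epigroup S m" and x: "x \<in> S"
  obtains y where "drazin x y"
proof -
  obtain n H e where n: "n > 0" and H: "H \<subseteq> S" "group (mk_group H m e)" and p: "spow x n \<in> H"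
    using assms unfolding epigroup_def sg_subgroup_def by (metis Suc_le_eq One_nat_def)
  define p where "p = spow x n"
  obtain g where g: "g \<in> H" "p \<cdot> g = e" "g \<cdot> p = e"
    using group_mk_groupD(4)[OF H(2) p] unfolding p_def by blast
  have S: "p \<in> S" "g \<in> S" "e \<in> S"
    using H p g group_mk_groupD(1)[OF H(2)] by (auto simp: p_def)
  have e: "e \<cdot> p = p" "p \<cdot> e = p" "e \<cdot> g = g" "g \<cdot> e = g"
    using group_mk_groupD(2,3)[OF H(2)] p g by (auto simp: p_def)
  have px: "p \<cdot> x = x \<cdot> p" unfolding p_def using pow_commute[of x x n] x n by simp
  \<comment> \<open>\<open>e x = g p x = g x p\<close> absorbs \<open>e\<close> on the right and
    \<open>x e = x p g = p x g\<close> absorbs it on the left, so both are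
    \<open>e x e\<close>.\<close>
  have ex: "e \<cdot> x = x \<cdot> e"
  proof -
    have "e \<cdot> x = g \<cdot> (x \<cdot> p)" using g S x px by (metis assoc)
    then have "e \<cdot> x \<cdot> e = e \<cdot> x" using S x e by (metis assoc closed)
    moreover have "x \<cdot> e = (p \<cdot> x) \<cdot> g" using g S x px by (metis assoc)
    then have "e \<cdot> (x \<cdot> e) = x \<cdot> e" using S x e by (metis assoc closed)
    ultimately show ?thesis using S x by (metis assoc)
  qed
  have gx: "g \<cdot> x = x \<cdot> g"
  proof -
    have "g \<cdot> x = (g \<cdot> e) \<cdot> x" using e by simp
    also have "\<dots> = g \<cdot> (x \<cdot> e)" using S x ex by (simp add: assoc)
    also have "\<dots> = g \<cdot> ((x \<cdot> p) \<cdot> g)" using S x g by (simp add: assoc)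
    also have "\<dots> = (g \<cdot> p) \<cdot> (x \<cdot> g)" using S x by (simp add: assoc flip: px)
    also have "\<dots> = (x \<cdot> e) \<cdot> g" using S x g ex by (simp flip: assoc)
    finally show ?thesis using S x e by (simp add: assoc)
  qed
  \<comment> \<open>The natural choice would be the power \<open>n - 1\<close> times
    \<open>g\<close>, but for \<open>n = 1\<close> its exponent is 0, where \<open>sg_pow\<close>
    returns \<open>x\<close> and not an identity. The exponent \<open>2 * n - 1\<close> is always
    positive.\<close>
  define y where "y = spow x (2 * n - 1) \<cdot> (g \<cdot> g)"
  have yS: "y \<in> S" using x S by (simp add: y_def)
  have "x \<cdot> spow x (2 * n - 1) = p \<cdot> p"
    using pow_Suc[of "2 * n - 1" x] pow_add[of x n n] n x by (simp add: p_def mult_2)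
  then have xy: "x \<cdot> y = e"
  proof -
    have "x \<cdot> y = (p \<cdot> p) \<cdot> (g \<cdot> g)"
      using \<open>x \<cdot> spow x (2 * n - 1) = p \<cdot> p\<close> x S by (simp add: y_def flip: assoc)
    also have "\<dots> = p \<cdot> ((p \<cdot> g) \<cdot> g)" using S by (simp add: assoc)
    finally show ?thesis using g e by simp
  qed
  have ggx: "(g \<cdot> g) \<cdot> x = x \<cdot> (g \<cdot> g)" using S x gx by (metis assoc)
  have yx: "y \<cdot> x = x \<cdot> y"
  proof -
    have "y \<cdot> x = spow x (2 * n - 1) \<cdot> (x \<cdot> (g \<cdot> g))"
      using x S ggx by (simp add: y_def assoc)
    also have "\<dots> = (x \<cdot> spow x (2 * n - 1)) \<cdot> (g \<cdot> g)"
      using x S pow_commute[of x x "2 * n - 1"] n by (simp flip: assoc)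
    finally show ?thesis using x S by (simp add: y_def assoc)
  qed
  have "y \<cdot> e = y" using x S e by (simp add: y_def assoc)
  then have "drazin x y"
    unfolding drazin_def using x yS yx xy n e by (metis p_def)
  then show thesis by (rule that)
qed

text \<open>With \<open>u = y x\<close>, everything follows from \<open>u d d = d = d d u\<close>:
  both products of \<open>z\<close> with \<open>x y\<close> are \<open>x d y\<close>. The index
  grows by one because the power \<open>Suc n\<close> of \<open>x y\<close> is \<open>x\<close>, the
  power \<open>n\<close> of \<open>u\<close>, and then \<open>y\<close>.\<close>

lemma drazin_cline:
  assumes S: "x \<in> S" "y \<in> S" and D: "drazin (y \<cdot> x) d"
  shows "drazin (x \<cdot> y) (x \<cdot> d \<cdot> d \<cdot> y)" and "(x \<cdot> d \<cdot> d \<cdot> y) \<cdot> x = x \<cdot> d"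
proof -
  obtain n where d: "d \<in> S" "(y \<cdot> x) \<cdot> d = d \<cdot> (y \<cdot> x)" "d \<cdot> ((y \<cdot> x) \<cdot> d) = d" and
    n: "n > 0" "spow (y \<cdot> x) n \<cdot> ((y \<cdot> x) \<cdot> d) = spow (y \<cdot> x) n"
    using D unfolding drazin_def by blast
  define u where "u = y \<cdot> x"
  have u: "u \<in> S" "u \<cdot> d = d \<cdot> u" "d \<cdot> (u \<cdot> d) = d" "spow u n \<cdot> (u \<cdot> d) = spow u n"
    using S d n by (simp_all add: u_def)
  have udd: "u \<cdot> (d \<cdot> d) = d" "(d \<cdot> d) \<cdot> u = d"
    using u d(1) by (metis assoc)+
  define z where "z = x \<cdot> d \<cdot> d \<cdot> y"
  have z: "z = x \<cdot> ((d \<cdot> d) \<cdot> y)" "z \<in> S" using S d by (simp_all add: z_def assoc)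
  show zx: "(x \<cdot> d \<cdot> d \<cdot> y) \<cdot> x = x \<cdot> d"
  proof -
    have "z \<cdot> x = x \<cdot> ((d \<cdot> d) \<cdot> u)" using S d by (simp add: z u_def assoc)
    then show ?thesis using udd by (simp add: z_def)
  qed
  then have zx': "z \<cdot> x = x \<cdot> d" by (simp add: z_def)
  have xyz: "(x \<cdot> y) \<cdot> z = x \<cdot> (d \<cdot> y)"
  proof -
    have "(x \<cdot> y) \<cdot> z = x \<cdot> ((u \<cdot> (d \<cdot> d)) \<cdot> y)" using S d by (simp add: z u_def assoc)
    then show ?thesis using udd by simp
  qed
  have zxy: "z \<cdot> (x \<cdot> y) = x \<cdot> (d \<cdot> y)"
  proof -
    have "z \<cdot> (x \<cdot> y) = (z \<cdot> x) \<cdot> y" using S z by (simp add: assoc)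
    then show ?thesis using S d by (simp add: zx' assoc)
  qed
  have zz: "z \<cdot> ((x \<cdot> y) \<cdot> z) = z"
  proof -
    have "z \<cdot> ((x \<cdot> y) \<cdot> z) = (z \<cdot> x) \<cdot> (d \<cdot> y)" using S d z(2) by (simp add: xyz assoc)
    also have "\<dots> = (x \<cdot> d) \<cdot> (d \<cdot> y)" by (simp only: zx')
    finally show ?thesis using S d by (simp add: z(1) assoc)
  qed
  have "spow (x \<cdot> y) (Suc n) \<cdot> ((x \<cdot> y) \<cdot> z) = spow (x \<cdot> y) (Suc n)"
  proof -
    have shift: "spow (x \<cdot> y) k \<cdot> x = x \<cdot> spow u k" if "k > 0" for k
      using that S by (intro pow_intertwine) (simp_all add: u_def assoc)
    have "spow (x \<cdot> y) (Suc n) \<cdot> ((x \<cdot> y) \<cdot> z) = (spow (x \<cdot> y) (Suc n) \<cdot> x) \<cdot> (d \<cdot> y)"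
      using S d by (simp add: xyz assoc)
    also have "\<dots> = (x \<cdot> spow u (Suc n)) \<cdot> (d \<cdot> y)" by (simp only: shift[OF zero_less_Suc])
    also have "\<dots> = x \<cdot> ((spow u (Suc n) \<cdot> d) \<cdot> y)" using S d u by (simp add: assoc)
    also have "spow u (Suc n) \<cdot> d = spow u n"
      using assoc[of "spow u n" u d] u d n(1) by (simp add: pow_Suc_right)
    also have "x \<cdot> (spow u n \<cdot> y) = (x \<cdot> spow u n) \<cdot> y" using S u by (simp add: assoc)
    also have "\<dots> = (spow (x \<cdot> y) n \<cdot> x) \<cdot> y" by (simp only: shift[OF n(1)])
    also have "\<dots> = spow (x \<cdot> y) (Suc n)" using S n(1) by (simp add: pow_Suc_right assoc)
    finally show ?thesis .
  qed
  then show "drazin (x \<cdot> y) (x \<cdot> d \<cdot> d \<cdot> y)"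
    unfolding drazin_def z_def[symmetric] using S z xyz zxy zz by auto
qed

lemma omega_pow_closed: "drazin x d \<Longrightarrow> omega_pow S m x q \<in> S"
proof -
  assume D: "drazin x d"
  then have "x \<in> S" "d \<in> S" unfolding drazin_def by auto
  then show ?thesis by (simp add: omega_pow_def drazin_pseudo_inv[OF D])
qed

lemma omega_pow_nonneg:
  "drazin x d \<Longrightarrow> q \<ge> 0 \<Longrightarrow> omega_pow S m x q = d \<cdot> spow x (nat (q + 1))"
  by (simp add: omega_pow_def drazin_pseudo_inv)

lemma omega_pow_neg: "drazin x d \<Longrightarrow> q < 0 \<Longrightarrow> omega_pow S m x q = spow d (nat (- q))"
  by (simp add: omega_pow_def drazin_pseudo_inv)

text \<open>The formula for the omega-power changes between the exponents -1 and 0, so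
  \<open>q = 0\<close> is a case of its own, where the claim is that \<open>x\<close> and
  \<open>d\<close> commute.\<close>

lemma omega_pow_unfold_left:
  assumes D: "drazin x d"
  shows "omega_pow S m x q = x \<cdot> omega_pow S m x (q - 1)"
proof -
  have S: "x \<in> S" "d \<in> S" and xd: "x \<cdot> d = d \<cdot> x" "d \<cdot> (x \<cdot> d) = d"
    using D unfolding drazin_def by auto
  consider "q > 0" | "q = 0" | "q < 0" by linarith
  then show ?thesis
  proof cases
    case 1
    define k where "k = nat q"
    have k: "k > 0" "nat (q + 1) = Suc k" "nat (q - 1 + 1) = k" using 1 by (auto simp: k_def)
    have "d \<cdot> spow x (Suc k) = (d \<cdot> x) \<cdot> spow x k" using S k by (simp add: pow_Suc assoc)
    also have "\<dots> = x \<cdot> (d \<cdot> spow x k)" using assoc[of x d "spow x k"] S xd(1) by simp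
    finally show ?thesis
      using 1 k omega_pow_nonneg[OF D, of q] omega_pow_nonneg[OF D, of "q - 1"] by simp
  next
    case 2
    then show ?thesis
      using xd omega_pow_nonneg[OF D, of q] omega_pow_neg[OF D, of "q - 1"] by simp
  next
    case 3
    define k where "k = nat (- q)"
    have k: "k > 0" "nat (- (q - 1)) = Suc k" using 3 by (auto simp: k_def)
    have "spow d k \<cdot> (x \<cdot> d) = spow d k" using pow_absorb[of d "x \<cdot> d" k] S xd k by simp
    moreover have "d \<cdot> (x \<cdot> d) = (x \<cdot> d) \<cdot> d" using assoc[of d x d] S xd(1) by simp
    then have "spow d k \<cdot> (x \<cdot> d) = (x \<cdot> d) \<cdot> spow d k"
      using S k by (intro pow_commute) simp_all
    then have "x \<cdot> spow d (Suc k) = spow d k \<cdot> (x \<cdot> d)" using S k by (simp add: pow_Suc assoc)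
    ultimately show ?thesis
      using 3 k omega_pow_neg[OF D, of q] omega_pow_neg[OF D, of "q - 1"] by (simp add: k_def)
  qed
qed

text \<open>Moving \<open>x\<close> across turns \<open>y x\<close> into \<open>x y\<close>, and by
  Cline's formula it turns \<open>d\<close> into \<open>z\<close>; hence it does so for their
  powers.\<close>

lemma omega_pow_shift:
  assumes S: "x \<in> S" "y \<in> S" and D: "drazin (y \<cdot> x) d"
  shows "x \<cdot> omega_pow S m (y \<cdot> x) q = omega_pow S m (x \<cdot> y) q \<cdot> x"
proof -
  define z where "z = x \<cdot> d \<cdot> d \<cdot> y"
  have Z: "drazin (x \<cdot> y) z" and zx: "z \<cdot> x = x \<cdot> d" using drazin_cline[OF S D] by (auto simp: z_def)
  have dS: "d \<in> S" "z \<in> S" using D Z unfolding drazin_def by auto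
  show ?thesis
  proof (cases "q \<ge> 0")
    case True
    define k where "k = nat (q + 1)"
    have "spow (x \<cdot> y) k \<cdot> x = x \<cdot> spow (y \<cdot> x) k"
      using True S by (intro pow_intertwine) (simp_all add: assoc k_def)
    then have "(z \<cdot> spow (x \<cdot> y) k) \<cdot> x = x \<cdot> (d \<cdot> spow (y \<cdot> x) k)"
      using S dS zx by (metis assoc closed pow_closed)
    then show ?thesis
      using True by (simp add: omega_pow_nonneg[OF D] omega_pow_nonneg[OF Z] k_def)
  next
    case False
    then have "spow z (nat (- q)) \<cdot> x = x \<cdot> spow d (nat (- q))"
      using S dS zx by (intro pow_intertwine) simp_all
    then show ?thesis using False by (simp add: omega_pow_neg[OF D] omega_pow_neg[OF Z])
  qed
qed

lemma omega_pow_commute: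
  assumes D: "drazin x d"
  shows "x \<cdot> omega_pow S m x q = omega_pow S m x q \<cdot> x"
proof -
  have S: "x \<in> S" "d \<in> S" and xd: "x \<cdot> d = d \<cdot> x" using D unfolding drazin_def by auto
  show ?thesis
  proof (cases "q \<ge> 0")
    case True
    then have "spow x (nat (q + 1)) \<cdot> x = x \<cdot> spow x (nat (q + 1))"
      using S by (intro pow_commute) simp_all
    then have "d \<cdot> spow x (nat (q + 1)) \<cdot> x = x \<cdot> (d \<cdot> spow x (nat (q + 1)))"
      using S xd by (metis assoc pow_closed)
    then show ?thesis using True by (simp add: omega_pow_nonneg[OF D])
  next
    case False
    then have "spow d (nat (- q)) \<cdot> x = x \<cdot> spow d (nat (- q))"
      using S xd by (intro pow_commute) simp_all
    then show ?thesis using False by (simp add: omega_pow_neg[OF D])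
  qed
qed

lemma sg_prod_Cons: "w \<noteq> [] \<Longrightarrow> set (x # w) \<subseteq> S \<Longrightarrow> sg_prod m (x # w) = x \<cdot> sg_prod m w"
proof -
  have "foldl m (x \<cdot> y) w = x \<cdot> foldl m y w" if "x \<in> S" "y \<in> S" "set w \<subseteq> S" for x y w
    using that by (induction w arbitrary: y) (auto simp: assoc)
  then show "w \<noteq> [] \<Longrightarrow> set (x # w) \<subseteq> S \<Longrightarrow> sg_prod m (x # w) = x \<cdot> sg_prod m w"
    by (cases w) (auto simp: sg_prod_def)
qed

lemma sg_prod_singleton [simp]: "sg_prod m [x] = x"
  by (simp add: sg_prod_def)

lemma sg_prod_closed: "w \<noteq> [] \<Longrightarrow> set w \<subseteq> S \<Longrightarrow> sg_prod m w \<in> S"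
proof (induction w)
  case (Cons x w)
  then show ?case by (cases "w = []") (simp_all add: sg_prod_Cons)
qed simp

lemma sg_prod_append:
  "u \<noteq> [] \<Longrightarrow> v \<noteq> [] \<Longrightarrow> set u \<subseteq> S \<Longrightarrow> set v \<subseteq> S \<Longrightarrow> sg_prod m (u @ v) = sg_prod m u \<cdot> sg_prod m v"
proof (induction u)
  case (Cons x u)
  then show ?case
    by (cases "u = []") (simp_all add: sg_prod_Cons sg_prod_closed assoc)
qed simp

end

section \<open>Evaluation in epigroups\<close>

locale epigroup_evaluation = carrier_semigroup S m for S :: "'s set" and m (infixl "\<cdot>" 70) +
  fixes \<phi> :: "'a \<Rightarrow> 's"
  assumes epigroup: "epigroup S m" and range: "range \<phi> \<subseteq> S"
begin

abbreviation eval :: "'a zword \<Rightarrow> 's" where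
  "eval \<equiv> eval_zword S m \<phi>"

lemma eval_factors_closed: "w \<in> ZWords \<Longrightarrow> set (map (eval_zfactor S m \<phi>) w) \<subseteq> S"
proof (induction rule: ZWords.induct)
  case (power w q)
  then have "sg_prod m (map (eval_zfactor S m \<phi>) w) \<in> S" by (intro sg_prod_closed) auto
  then obtain d where "drazin (sg_prod m (map (eval_zfactor S m \<phi>) w)) d"
    using epigroup_drazin[OF epigroup] by blast
  then show ?case by (simp add: omega_pow_closed)
qed (use range in auto)

lemma eval_closed: "w \<in> ne_ZWords \<Longrightarrow> eval w \<in> S"
  using sg_prod_closed[of "map (eval_zfactor S m \<phi>) w"] eval_factors_closed[of w]
  by (auto simp: eval_zword_def ne_ZWords_def)

lemma eval_append: "u \<in> ne_ZWords \<Longrightarrow> v \<in> ne_ZWords \<Longrightarrow> eval (u @ v) = eval u \<cdot> eval v"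
  using eval_factors_closed[of u] eval_factors_closed[of v]
  by (simp add: eval_zword_def ne_ZWords_def sg_prod_append)

lemma eval_OmegaPow: "eval [OmegaPow x q] = omega_pow S m (eval x) q"
  by (simp add: eval_zword_def)

lemma eval_drazin: obtains d where "x \<in> ne_ZWords \<Longrightarrow> drazin (eval x) d"
  using epigroup_drazin[OF epigroup eval_closed] by blast

lemma sword_eq_eval: "x \<approx> y \<Longrightarrow> eval x = eval y"
proof (induction rule: sword_rel.induct)
  case (concat \<sigma> \<sigma>' \<tau> \<tau>')
  \<comment> \<open>\<open>sg_prod\<close> of the empty list is an unspecified value, so empty
    factors have to be split off; they are empty on both sides at once.\<close>
  have "\<sigma> \<in> ZWords" "\<sigma>' \<in> ZWords" "\<tau> \<in> ZWords" "\<tau>' \<in> ZWords" "\<sigma> = [] \<longleftrightarrow> \<sigma>' = []" "\<tau> = [] \<longleftrightarrow> \<tau>' = []"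
    using sword_eq_ZWords[OF concat.hyps(1)] sword_eq_ZWords[OF concat.hyps(2)] by auto
  then show ?case
    using concat.IH eval_append[of \<sigma> \<tau>] eval_append[of \<sigma>' \<tau>']
    by (cases "\<sigma> = []"; cases "\<tau> = []") (auto simp: ne_ZWords_def)
next
  case (unfold_left x q)
  then obtain d where "drazin (eval x) d" using eval_drazin by blast
  then show ?case
    using omega_pow_unfold_left[of "eval x" d q] unfold_left
    by (simp add: eval_append eval_OmegaPow ne_ZWords_def)
next
  case (unfold_right x q)
  then obtain d where "drazin (eval x) d" using eval_drazin by blast
  then show ?case
    using omega_pow_unfold_left[of "eval x" d q] omega_pow_commute[of "eval x" d "q - 1"] unfold_right
    by (simp add: eval_append[of "[OmegaPow x (q - 1)]" x, simplified] eval_OmegaPow ne_ZWords_def)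
next
  case (shift x y q)
  then have yx: "y @ x \<in> ne_ZWords" "x @ y \<in> ne_ZWords" by (auto simp: ne_ZWords_def)
  obtain d where "drazin (eval y \<cdot> eval x) d"
    using eval_drazin[of "y @ x"] yx eval_append[OF shift(2,1)] by metis
  then have "eval x \<cdot> omega_pow S m (eval y \<cdot> eval x) q = omega_pow S m (eval x \<cdot> eval y) q \<cdot> eval x"
    using shift by (intro omega_pow_shift eval_closed)
  moreover have "eval (x @ [OmegaPow (y @ x) q]) = eval x \<cdot> eval [OmegaPow (y @ x) q]"
    "eval ([OmegaPow (x @ y) q] @ x) = eval [OmegaPow (x @ y) q] \<cdot> eval x"
    using shift yx by (intro eval_append; simp add: ne_ZWords_def)+
  moreover have "eval (y @ x) = eval y \<cdot> eval x" "eval (x @ y) = eval x \<cdot> eval y"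
    using eval_append[OF shift(2,1)] eval_append[OF shift(1,2)] by simp_all
  ultimately show ?case by (simp only: eval_OmegaPow)
qed (simp_all add: eval_OmegaPow)

end

lemma holds_in_epigroups_refl:
  assumes "\<sigma> \<in> swords"
  shows "holds_in_epigroups TYPE('s) \<sigma> \<sigma>"
  unfolding holds_in_epigroups_def sword_identity_def word_identity_def
proof (intro allI impI ballI)
  fix S :: "'s set" and m \<alpha> \<alpha>' and \<phi> :: "'a \<Rightarrow> 's"
  assume S: "epigroup S m" "range \<phi> \<subseteq> S" and \<alpha>: "\<alpha> \<in> \<sigma>" "\<alpha>' \<in> \<sigma>"
  interpret epigroup_evaluation S m \<phi>
    using S by unfold_locales (auto simp: epigroup_def)
  have "\<alpha> \<approx> \<alpha>'"
    using assms \<alpha> unfolding swords_def quotient_def by (auto intro: sword_rel.sym sword_rel.trans)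
  then show "eval_zword S m \<phi> \<alpha> = eval_zword S m \<phi> \<alpha>'" by (rule sword_eq_eval)
qed

section \<open>Finite semigroups\<close>

locale finite_semigroup = carrier_semigroup S m for S :: "'s set" and m (infixl "\<cdot>" 70) +
  assumes finite: "finite S"
begin

lemma element_period:
  assumes x: "x \<in> S"
  obtains i p where "i > 0" "p > 0" "\<And>n. n \<ge> i \<Longrightarrow> spow x (n + p) = spow x n"
proof -
  have "\<not> inj_on (spow x) {1..}"
  proof
    assume "inj_on (spow x) {1..}"
    moreover have "spow x ` {1..} \<subseteq> S" using x by auto
    then have "finite (spow x ` {1..})" using finite by (rule finite_subset)
    ultimately have "finite {1 :: nat..}" using finite_imageD by blast
    then show False using infinite_Ici by blast
  qed
  then obtain i j where ij: "i > 0" "i < j" "spow x i = spow x j"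
    unfolding inj_on_def by (metis atLeast_iff linorder_neqE_nat One_nat_def Suc_le_eq)
  have "spow x (n + (j - i)) = spow x n" if "n \<ge> i" for n
  proof (cases "n = i")
    case False
    then have "n + (j - i) = (n - i) + j" "(n - i) + i = n" "n - i > 0" "j > 0" using ij that by auto
    then show ?thesis using pow_add[OF x, of "n - i" i] pow_add[OF x, of "n - i" j] ij by simp
  qed (use ij in simp)
  then show thesis using that[of i "j - i"] ij by auto
qed

lemma common_period:
  obtains i p where "i > 0" "p > 0"
    "\<And>x n k. x \<in> S \<Longrightarrow> n \<ge> i \<Longrightarrow> p dvd k \<Longrightarrow> spow x (n + k) = spow x n"
proof -
  have "\<exists>i p. i > 0 \<and> p > 0 \<and> (\<forall>n\<ge>i. spow x (n + p) = spow x n)" if "x \<in> S" for x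
    using element_period[OF that] by metis
  then obtain i p where ip: "\<And>x. x \<in> S \<Longrightarrow> i x > 0 \<and> p x > (0 :: nat)"
      "\<And>x n. x \<in> S \<Longrightarrow> n \<ge> i x \<Longrightarrow> spow x (n + p x) = spow x n"
    by metis
  have mult: "spow x (n + p x * k) = spow x n" if "x \<in> S" "n \<ge> i x" for x n k
  proof (induction k)
    case (Suc k)
    have "n + p x * Suc k = (n + p x * k) + p x" by simp
    then have "spow x (n + p x * Suc k) = spow x ((n + p x * k) + p x)" by (simp only:)
    then show ?case using Suc ip(2)[of x "n + p x * k"] that by simp
  qed simp
  show thesis
  proof (rule that)
    \<comment> \<open>The sum bounds every index and the product is a multiple of every period;
      \<open>Suc\<close> keeps the index positive even for an empty carrier.\<close>
    show "Suc (sum i S) > 0" by simp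
    show "prod p S > 0" using ip(1) by (simp add: prod_pos)
    fix x n k
    assume x: "x \<in> S" "n \<ge> Suc (sum i S)" "prod p S dvd k"
    have "i x \<le> sum i S" "p x dvd prod p S"
      using x(1) finite by (auto intro: member_le_sum)
    then obtain j where "k = p x * j" "n \<ge> i x"
      using x dvd_trans[of "p x" "prod p S" k] by auto
    then show "spow x (n + k) = spow x n" using mult x(1) by simp
  qed
qed

text \<open>If \<open>N\<close> is large and divisible by a common period, multiplying a high power
  of \<open>x\<close> by the power \<open>N\<close> changes nothing. So the power
  \<open>N - 1\<close> of \<open>x\<close> is its Drazin inverse.\<close>

lemma omega_pow_finite:
  obtains P where "P > 0"
    "\<And>q. \<exists>N0. \<forall>N\<ge>N0. P dvd N \<longrightarrow> nat (int N + q) > 0 \<and>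
      (\<forall>x\<in>S. omega_pow S m x q = spow x (nat (int N + q)))"
proof -
  obtain i P where i: "i > 0" and P: "P > 0" and
    period: "\<And>x n k. x \<in> S \<Longrightarrow> n \<ge> i \<Longrightarrow> P dvd k \<Longrightarrow> spow x (n + k) = spow x n"
    using common_period by metis
  have drazin: "drazin x (spow x (N - 1))" if x: "x \<in> S" and N: "N \<ge> i + 2" "P dvd N" for x N
  proof -
    have comm: "x \<cdot> spow x (N - 1) = spow x (N - 1) \<cdot> x"
      using pow_commute[of x x "N - 1"] x N by simp
    have xN: "x \<cdot> spow x (N - 1) = spow x N" using pow_Suc[of "N - 1" x] N by simp
    have "spow x (N - 1) \<cdot> spow x N = spow x (N - 1)"
      using pow_add[of x "N - 1" N] period[OF x, of "N - 1" N] x N by simp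
    moreover have "spow x i \<cdot> spow x N = spow x i"
      using pow_add[of x i N] period[OF x, of i N] x N i by simp
    ultimately show ?thesis unfolding drazin_def xN using x comm xN i by auto
  qed
  show thesis
  proof (rule that[OF P])
    fix q :: int
    have "nat (int N + q) > 0 \<and> (\<forall>x\<in>S. omega_pow S m x q = spow x (nat (int N + q)))"
      if N: "N \<ge> i + 2 + nat \<bar>q\<bar>" "P dvd N" for N
    proof (intro conjI ballI)
      show "nat (int N + q) > 0" using N i by linarith
      fix x
      assume x: "x \<in> S"
      have D: "drazin x (spow x (N - 1))" using drazin x N by simp
      show "omega_pow S m x q = spow x (nat (int N + q))"
      proof (cases "q \<ge> 0")
        case True
        have "N - 1 + nat (q + 1) = nat (int N + q)" using True N by linarith
        then show ?thesis
          using omega_pow_nonneg[OF D True] pow_add[of x "N - 1" "nat (q + 1)"] x True N by simp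
      next
        case False
        define k where "k = nat (- q)"
        have k: "k > 0" "nat (int N + q) = N - k" "N - k \<ge> i" using False N by (auto simp: k_def)
        obtain k' where k': "k = Suc k'" using k by (cases k) auto
        \<comment> \<open>The exponent of the inverse raised to \<open>k\<close> exceeds
          \<open>N - k\<close> by a multiple of the period.\<close>
        have "(N - 1) * k = (N - k) + N * k'"
        proof -
          have "int ((N - 1) * k) = int ((N - k) + N * k')"
            using N k k' by (simp add: algebra_simps)
          then show ?thesis by (simp only: of_nat_eq_iff)
        qed
        then show ?thesis
          using omega_pow_neg[OF D, of q] False pow_mult[of x "N - 1" k] x k N
            period[OF x, of "N - k" "N * k'"] by (simp add: k_def)
      qed
    qed
    then show "\<exists>N0. \<forall>N\<ge>N0. P dvd N \<longrightarrow> nat (int N + q) > 0 \<and>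
      (\<forall>x\<in>S. omega_pow S m x q = spow x (nat (int N + q)))" by blast
  qed
qed

text \<open>An exponent that is a multiple of the period and at least the index yields an idempotent
  power, which is a subgroup on its own.\<close>

lemma epigroup_finite: "epigroup S m"
  unfolding epigroup_def
proof (intro conjI ballI)
  fix x
  assume x: "x \<in> S"
  obtain i p where ip: "i > 0" "p > 0"
    "\<And>x n k. x \<in> S \<Longrightarrow> n \<ge> i \<Longrightarrow> p dvd k \<Longrightarrow> spow x (n + k) = spow x n"
    using common_period by metis
  define e where "e = spow x (p * i)"
  have "p * i \<ge> i" using ip by simp
  then have "e \<cdot> e = e"
    using ip(3)[OF x, of "p * i" "p * i"] pow_add[of x "p * i" "p * i"] x ip by (simp add: e_def)
  moreover have "e \<in> S" using x by (simp add: e_def)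
  ultimately have "sg_subgroup S m {e}"
    unfolding sg_subgroup_def by (auto intro!: exI[of _ e] groupI)
  then show "\<exists>n\<ge>1. \<exists>G. sg_subgroup S m G \<and> spow x n \<in> G"
    using ip by (intro exI[of _ "p * i"] conjI exI[of _ "{e}"]) (auto simp: e_def Suc_le_eq)
qed (rule semigroup_on)

text \<open>\<open>h\<close> is a morphism on non-empty words, and in a finite semigroup omega + q
  acts like the number \<open>N + q\<close>. \<open>P\<close> is fixed before \<open>w\<close>, so a
  single \<open>N\<close> can serve two words.\<close>

lemma eval_realize:
  fixes h :: "'a list \<Rightarrow> 's"
  assumes h: "\<And>u. u \<noteq> [] \<Longrightarrow> h u \<in> S" "\<And>u v. u \<noteq> [] \<Longrightarrow> v \<noteq> [] \<Longrightarrow> h (u @ v) = h u \<cdot> h v"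
  obtains P where "P > 0" "\<And>w. w \<in> ne_ZWords \<Longrightarrow>
    \<exists>N0. \<forall>N\<ge>N0. P dvd N \<longrightarrow> eval_zword S m (\<lambda>a. h [a]) w = h (realize N w)"
proof -
  obtain P where P: "P > 0" and
    omega: "\<And>q. \<exists>N0. \<forall>N\<ge>N0. P dvd N \<longrightarrow> nat (int N + q) > 0 \<and>
      (\<forall>x\<in>S. omega_pow S m x q = spow x (nat (int N + q)))"
    using omega_pow_finite by metis
  interpret epigroup_evaluation S m "\<lambda>a. h [a]"
    using h epigroup_finite by unfold_locales auto
  have rep: "concat (replicate n u) \<noteq> [] \<and> h (concat (replicate n u)) = spow (h u) n"
    if "u \<noteq> []" "n > 0" for u n
    using \<open>n > 0\<close>
  proof (induction n)
    case (Suc n)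
    then show ?case using that(1) by (cases "n = 0") (simp_all add: pow_Suc h)
  qed simp
  \<comment> \<open>Non-emptiness of the realization is carried along because \<open>h\<close> is
    multiplicative on non-empty words only.\<close>
  have "w \<noteq> [] \<longrightarrow> (\<exists>N0. \<forall>N\<ge>N0. P dvd N \<longrightarrow> realize N w \<noteq> [] \<and> eval w = h (realize N w))"
    if "w \<in> ZWords" for w
    using that
  proof (induction rule: ZWords.induct)
    case (letter a)
    then show ?case by (simp add: eval_zword_def)
  next
    case (power x q)
    then obtain N1 where N1: "\<forall>N\<ge>N1. P dvd N \<longrightarrow> realize N x \<noteq> [] \<and> eval x = h (realize N x)" by blast
    obtain N2 where N2: "\<forall>N\<ge>N2. P dvd N \<longrightarrow> nat (int N + q) > 0 \<and>
      (\<forall>x\<in>S. omega_pow S m x q = spow x (nat (int N + q)))" using omega by blast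
    have "realize N [OmegaPow x q] \<noteq> [] \<and> eval [OmegaPow x q] = h (realize N [OmegaPow x q])"
      if N: "N \<ge> max N1 N2" "P dvd N" for N
    proof -
      have x: "realize N x \<noteq> []" "eval x = h (realize N x)" and n: "nat (int N + q) > 0"
        and *: "\<forall>x\<in>S. omega_pow S m x q = spow x (nat (int N + q))"
        using N N1 N2 by auto
      have "eval [OmegaPow x q] = spow (h (realize N x)) (nat (int N + q))"
        using * x h(1)[OF x(1)] by (simp add: eval_OmegaPow)
      then show ?thesis using rep[OF x(1) n] by simp
    qed
    then show ?case by blast
  next
    case (concat u v)
    show ?case
    proof (cases "u = [] \<or> v = []")
      case True
      then show ?thesis using concat.IH by auto
    next
      case False
      then obtain N1 N2 where "\<forall>N\<ge>N1. P dvd N \<longrightarrow> realize N u \<noteq> [] \<and> eval u = h (realize N u)"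
        "\<forall>N\<ge>N2. P dvd N \<longrightarrow> realize N v \<noteq> [] \<and> eval v = h (realize N v)"
        using concat.IH by blast
      then show ?thesis
        using eval_append[of u v] concat.hyps False h(2)
        by (intro impI exI[of _ "max N1 N2"]) (auto simp: ne_ZWords_def)
    qed
  qed simp
  then show thesis using that[OF P] unfolding ne_ZWords_def by blast
qed

end

text \<open>The extensional maps of \<open>Q\<close> to itself form a finite semigroup that contains
  all transition maps; an infinite type has room for a copy. Sending a word to its transition map is
  a morphism, so different runs become different values.\<close>

lemma separable_finite_epigroup:
  fixes x y :: "'a zword"
  assumes inf: "infinite (UNIV :: 's set)" and xy: "x \<in> ne_ZWords" "y \<in> ne_ZWords"
    and sep: "separable x y"
  shows "\<exists>(S :: 's set) m. epigroup S m \<and> finite S \<and> \<not> word_identity S m x y"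
proof -
  obtain \<delta> :: "nat \<Rightarrow> 'a \<Rightarrow> nat" and Q s M N0 where
    Q: "finite Q" "s \<in> Q" "\<And>p b. p \<in> Q \<Longrightarrow> \<delta> p b \<in> Q" "M > 0" and
    neq: "\<And>N. N \<ge> N0 \<Longrightarrow> M dvd N \<Longrightarrow> foldl \<delta> s (realize N x) \<noteq> foldl \<delta> s (realize N y)"
    using sep unfolding separable_def by blast
  define F where "F = (Q \<rightarrow>\<^sub>E Q)"
  have "finite F" unfolding F_def using Q(1) by (simp add: finite_PiE)
  obtain A :: "'s set" where "finite A" "card A = card F"
    using infinite_arbitrarily_large[OF inf] by blast
  then obtain g :: "(nat \<Rightarrow> nat) \<Rightarrow> 's" where "bij_betw g F A"
    using finite_same_card_bij[OF \<open>finite F\<close>] by metis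
  then have g: "inj_on g F" by (rule bij_betw_imp_inj_on)
  define g' where "g' = inv_into F g"
  define S where "S = g ` F"
  \<comment> \<open>The first factor acts first, matching the left-to-right run of
    \<open>foldl\<close>.\<close>
  define m where "m a b = g (compose Q (g' b) (g' a))" for a b
  have g'g: "g' (g f) = f" if "f \<in> F" for f using that by (simp add: g'_def g)
  have comp: "compose Q f1 f2 \<in> F" if "f1 \<in> F" "f2 \<in> F" for f1 f2
    using that unfolding F_def by (auto simp: compose_def)
  have m: "m (g f1) (g f2) = g (compose Q f2 f1)" if "f1 \<in> F" "f2 \<in> F" for f1 f2
    using that by (simp add: m_def g'g)
  have "semigroup_on S m"
    unfolding semigroup_on_def
  proof (intro conjI ballI)
    fix a b
    assume "a \<in> S" "b \<in> S"
    then show "m a b \<in> S" by (auto simp: S_def m comp)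
  next
    fix a b c
    assume "a \<in> S" "b \<in> S" "c \<in> S"
    then obtain f1 f2 f3 where f: "f1 \<in> F" "f2 \<in> F" "f3 \<in> F" "a = g f1" "b = g f2" "c = g f3"
      by (auto simp: S_def)
    have "compose Q f3 (compose Q f2 f1) = compose Q (compose Q f3 f2) f1"
      using f unfolding F_def by (intro compose_assoc[of f1 Q Q]) auto
    then show "m (m a b) c = m a (m b c)" using f by (simp add: m comp)
  qed
  then interpret finite_semigroup S m
    using \<open>finite F\<close> by unfold_locales (auto simp: S_def)
  define T where "T w = (\<lambda>p\<in>Q. foldl \<delta> p w)" for w
  have run: "foldl \<delta> p w \<in> Q" if "p \<in> Q" for p w
    using that Q(3) by (induction w arbitrary: p) auto
  have T: "T w \<in> F" for w unfolding T_def F_def using run by auto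
  have "T (u @ v) = compose Q (T v) (T u)" for u v
    using run by (auto simp: T_def compose_def)
  then have h: "g (T (u @ v)) = m (g (T u)) (g (T v))" for u v by (simp add: m T)
  obtain P where P: "P > 0" "\<And>w. w \<in> ne_ZWords \<Longrightarrow>
      \<exists>N0. \<forall>N\<ge>N0. P dvd N \<longrightarrow> eval_zword S m (\<lambda>a. g (T [a])) w = g (T (realize N w))"
    using eval_realize[of "\<lambda>w. g (T w)"] h T unfolding S_def by (metis imageI)
  obtain N1 N2 where
    N1: "\<forall>N\<ge>N1. P dvd N \<longrightarrow> eval_zword S m (\<lambda>a. g (T [a])) x = g (T (realize N x))" and
    N2: "\<forall>N\<ge>N2. P dvd N \<longrightarrow> eval_zword S m (\<lambda>a. g (T [a])) y = g (T (realize N y))"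
    using P(2) xy by meson
  have "\<not> word_identity S m x y"
  proof
    assume "word_identity S m x y"
    moreover have "range (\<lambda>a. g (T [a])) \<subseteq> S" using T by (auto simp: S_def)
    ultimately have eq: "eval_zword S m (\<lambda>a. g (T [a])) x = eval_zword S m (\<lambda>a. g (T [a])) y"
      unfolding word_identity_def by blast
    \<comment> \<open>A common multiple of both periods beyond all three bounds.\<close>
    define N where "N = P * M * (N0 + N1 + N2)"
    have "P * M \<ge> 1" using P(1) Q(4) by (simp add: Suc_le_eq)
    then have N: "N \<ge> N0 + N1 + N2"
      unfolding N_def using mult_le_mono1[of 1 "P * M" "N0 + N1 + N2"] by simp
    have dvd: "P dvd N" "M dvd N" by (simp_all add: N_def)
    have "eval_zword S m (\<lambda>a. g (T [a])) x = g (T (realize N x))"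
        "eval_zword S m (\<lambda>a. g (T [a])) y = g (T (realize N y))"
      using N1 N2 N dvd by simp_all
    with eq have "g (T (realize N x)) = g (T (realize N y))" by (simp only:)
    then have "T (realize N x) s = T (realize N y) s" using g'g T by metis
    then show False using neq[of N] N dvd Q(2) by (simp add: T_def)
  qed
  then show ?thesis using epigroup_finite finite by blast
qed

theorem proposition6:
  fixes \<sigma>1 \<sigma>2 :: "'a zword set"
  assumes "infinite (UNIV :: 's set)"
    and "normal_sword \<sigma>1" and "\<sigma>1 \<noteq> empty_sword"
    and "normal_sword \<sigma>2" and "\<sigma>2 \<noteq> empty_sword"
  shows "(holds_in_epigroups TYPE('s) \<sigma>1 \<sigma>2 \<longleftrightarrow> \<sigma>1 = \<sigma>2) \<and>
         (holds_in_finite_epigroups TYPE('s) \<sigma>1 \<sigma>2 \<longleftrightarrow> \<sigma>1 = \<sigma>2)"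
proof -
  have swords: "\<sigma>1 \<in> swords" "\<sigma>2 \<in> swords" using assms unfolding normal_sword_def by auto
  obtain x y where x: "x \<in> ZWords" "\<sigma>1 = sword_rel `` {x}" and y: "y \<in> ZWords" "\<sigma>2 = sword_rel `` {y}"
    using swords unfolding swords_def by (auto elim!: quotientE)
  have ne: "x \<in> ne_ZWords" "y \<in> ne_ZWords"
    using x y assms unfolding ne_ZWords_def empty_sword_def by auto
  have mem: "x \<in> \<sigma>1" "y \<in> \<sigma>2" using x y by (auto intro: sword_rel.refl)
  \<comment> \<open>The two equivalences follow from a cycle: validity in finite epigroups gives
    equality, equality gives validity in all epigroups, and this includes the finite ones.\<close>
  have "\<sigma>1 = \<sigma>2" if fin: "holds_in_finite_epigroups TYPE('s) \<sigma>1 \<sigma>2"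
  proof (rule ccontr)
    assume "\<sigma>1 \<noteq> \<sigma>2"
    have "\<not> x \<approx> y"
    proof
      assume xy: "x \<approx> y"
      have "\<sigma>1 = \<sigma>2" unfolding x(2) y(2)
        using sword_rel.trans[OF xy] sword_rel.trans[OF sword_rel.sym[OF xy]] by blast
      with \<open>\<sigma>1 \<noteq> \<sigma>2\<close> show False ..
    qed
    then have "separable x y"
      using irreducible_separable[OF x(1) y(1)] normal_sword_irreducible assms(2,4) mem by blast
    then obtain S :: "'s set" and m where "epigroup S m" "finite S" "\<not> word_identity S m x y"
      using separable_finite_epigroup[OF assms(1) ne] by blast
    then show False
      using fin mem unfolding holds_in_finite_epigroups_def sword_identity_def by blast
  qed
  moreover have "holds_in_finite_epigroups TYPE('s) \<sigma>1 \<sigma>2" if "holds_in_epigroups TYPE('s) \<sigma>1 \<sigma>2"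
    using that unfolding holds_in_epigroups_def holds_in_finite_epigroups_def by blast
  moreover have "holds_in_epigroups TYPE('s) \<sigma>1 \<sigma>2" if "\<sigma>1 = \<sigma>2"
    using that swords holds_in_epigroups_refl by blast
  ultimately show ?thesis by blast
qed

end
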